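(* Let $(\gamma,\nu):(I,t_0)\to\mathbb{R}^2\times S^1$, $\gamma(t)=(x(t),z(t))$, $\nu(t)=(a(t),b(t))$, be a Legendre curve with curvature $(\ell,\beta)$, where $\beta$ is real analytic around $t_0$. Let $J(t)=-\beta(t)x(t)$ and $K(t)=-a(t)\ell(t)$, and suppose that $K(t)=\alpha(t)J(t)$ where $\alpha(t)=c$ for a non-zero constant $c\in\mathbb{R}$. Suppose moreover that $x(t_0)\neq0$ and that $\operatorname{ord}(a)(t_0)=m+1\le\operatorname{ord}(\beta)(t_0)=n+1$ for non-negative integers $m,n$. Then $\gamma$ has (1) a $3/2$-cusp at $t_0$ if and only if $\operatorname{ord}(a)(t_0)=\operatorname{ord}(\beta)(t_0)=1$, (2) a $4/3$-cusp at $t_0$ if and only if $\operatorname{ord}(a)(t_0)=\operatorname{ord}(\beta)(t_0)=2$, (3) a $5/3$-cusp at $t_0$ if and only if $\operatorname{ord}(a)(t_0)=1$ and $\operatorname{ord}(\beta)(t_0)=2$. Moreover, $\gamma$ cannot have a $5/2$-cusp at $t_0$.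
   Context: All maps are $C^\infty$ unless stated otherwise; $(I,t_0)$ is an interval with base point $t_0$. A Legendre curve is a smooth map $(\gamma,\nu):I\to\mathbb{R}^2\times S^1$ with $\dot\gamma\cdot\nu=0$. With $\boldsymbol{\mu}=(-b,a)$ (the rotation of $\nu=(a,b)$ by $\pi/2$), its curvature is $(\ell,\beta)=(\dot\nu\cdot\boldsymbol{\mu},\dot\gamma\cdot\boldsymbol{\mu})$, so $\dot x=-\beta b$, $\dot z=\beta a$, $\dot a=-\ell b$, $\dot b=\ell a$. $J$ and $K$ are the components $J^z_F,K^z_F$ of the curvature of the surface of revolution $(x(t)\cos\theta,x(t)\sin\theta,z(t))$ as a framed surface; where the surface is regular, $K/J$ is its Gauss curvature, so here it is the constant $c$. For a smooth function germ $f$ and integer $k\ge0$, $\operatorname{ord}(f)(t_0)=k+1$ means $f(t_0)=\dot f(t_0)=\cdots=f^{(k)}(t_0)=0$ and $f^{(k+1)}(t_0)\neq0$. Two smooth map-germs $f,g$ are $\mathcal{A}$-equivalent if $g=\Phi\circ f\circ\phi^{-1}$ for diffeomorphism germs $\phi$ of the source and $\Phi$ of the target (mapping base points to base points). For $(i,j)\in\{(2,3),(2,5),(3,4),(3,5)\}$, $\gamma$ has a $j/i$-cusp at $t_0$ if the germ of $\gamma$ at $t_0$ is $\mathcal{A}$-equivalent to the germ $t\mapsto(t^i,t^j)$ at the origin. *)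

theory Defs
  imports "HOL-Analysis.Analysis"
begin

text \<open>
  The derivatives are taken within \<open>S\<close>, which covers both open sets and intervals with endpoints.
  They are uniquely determined for open \<open>S\<close> and for nondegenerate intervals \<open>S\<close>, and the
  definition is only used for such sets.
\<close>

primrec Ck_on :: "nat \<Rightarrow> ('a::euclidean_space \<Rightarrow> 'b::euclidean_space) \<Rightarrow> 'a set \<Rightarrow> bool" where
  "Ck_on 0 f S \<longleftrightarrow> continuous_on S f"
| "Ck_on (Suc k) f S \<longleftrightarrow>
     f differentiable_on S \<and> (\<forall>v. Ck_on k (\<lambda>x. frechet_derivative f (at x within S) v) S)"

definition smooth_on :: "'a set \<Rightarrow> ('a::euclidean_space \<Rightarrow> 'b::euclidean_space) \<Rightarrow> bool" where
  "smooth_on S f \<longleftrightarrow> (\<forall>k. Ck_on k f S)"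

definition real_analytic_around :: "(real \<Rightarrow> real) \<Rightarrow> real \<Rightarrow> bool" where
  "real_analytic_around f t0 \<longleftrightarrow> (\<exists>F. (\<lambda>h. f (t0 + h)) has_fps_expansion F)"

text \<open>
  \<open>has_ord f t0 n\<close> is \<open>ord(f)(t0) = n\<close>, meaningful when \<open>f\<close> is smooth near \<open>t0\<close>.
\<close>

definition has_ord :: "(real \<Rightarrow> real) \<Rightarrow> real \<Rightarrow> nat \<Rightarrow> bool" where
  "has_ord f t0 n \<longleftrightarrow> (\<forall>i<n. (deriv ^^ i) f t0 = 0) \<and> (deriv ^^ n) f t0 \<noteq> 0"

definition legendre_curve :: "real set \<Rightarrow> (real \<Rightarrow> real \<times> real) \<Rightarrow> (real \<Rightarrow> real \<times> real) \<Rightarrow> bool" where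
  "legendre_curve I \<gamma> \<nu> \<longleftrightarrow>
     smooth_on I \<gamma> \<and> smooth_on I \<nu> \<and> (\<forall>t\<in>I. \<nu> t \<in> sphere 0 1) \<and>
     (\<forall>t\<in>I. vector_derivative \<gamma> (at t within I) \<bullet> \<nu> t = 0)"

definition rot90 :: "real \<times> real \<Rightarrow> real \<times> real" where
  "rot90 p = (- snd p, fst p)"

definition leg_ell :: "real set \<Rightarrow> (real \<Rightarrow> real \<times> real) \<Rightarrow> real \<Rightarrow> real" where
  "leg_ell I \<nu> t = vector_derivative \<nu> (at t within I) \<bullet> rot90 (\<nu> t)"

definition leg_beta :: "real set \<Rightarrow> (real \<Rightarrow> real \<times> real) \<Rightarrow> (real \<Rightarrow> real \<times> real) \<Rightarrow> real \<Rightarrow> real" where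
  "leg_beta I \<gamma> \<nu> t = vector_derivative \<gamma> (at t within I) \<bullet> rot90 (\<nu> t)"

definition diffeomorphism :: "'a::euclidean_space set \<Rightarrow> 'b::euclidean_space set \<Rightarrow>
    ('a \<Rightarrow> 'b) \<Rightarrow> ('b \<Rightarrow> 'a) \<Rightarrow> bool" where
  "diffeomorphism U V \<phi> \<psi> \<longleftrightarrow>
     open U \<and> open V \<and> homeomorphism U V \<phi> \<psi> \<and> smooth_on U \<phi> \<and> smooth_on V \<psi>"

text \<open>
  \<open>A_equivalent f p g q\<close>: the germ of \<open>f\<close> at \<open>p\<close> and the germ of \<open>g\<close> at \<open>q\<close> satisfy
  \<open>g = \<Phi> \<circ> f \<circ> \<phi>\<inverse>\<close>, where \<open>\<psi>\<close> and \<open>\<Psi>\<close> represent \<open>\<phi>\<inverse>\<close> and \<open>\<Phi>\<inverse>\<close>.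
\<close>

definition A_equivalent :: "('a::euclidean_space \<Rightarrow> 'b::euclidean_space) \<Rightarrow> 'a \<Rightarrow>
    ('a \<Rightarrow> 'b) \<Rightarrow> 'a \<Rightarrow> bool" where
  "A_equivalent f p g q \<longleftrightarrow>
     (\<exists>U V \<phi> \<psi> U' V' \<Phi> \<Psi>.
        diffeomorphism U V \<phi> \<psi> \<and> p \<in> U \<and> \<phi> p = q \<and>
        diffeomorphism U' V' \<Phi> \<Psi> \<and> f p \<in> U' \<and> \<Phi> (f p) = g q \<and>
        (\<forall>\<^sub>F s in nhds q. g s = \<Phi> (f (\<psi> s))))"

definition has_cusp :: "nat \<Rightarrow> nat \<Rightarrow> (real \<Rightarrow> real \<times> real) \<Rightarrow> real \<Rightarrow> bool" where
  "has_cusp j i \<gamma> t0 \<longleftrightarrow> A_equivalent \<gamma> t0 (\<lambda>t. (t ^ i, t ^ j)) 0"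

end

theory Submission
  imports Defs
begin

text \<open>
  The curvature equation reads \<open>a \<l> = c \<beta> x\<close>. Together with the Frenet equations it makes
  \<open>c x\<^sup>2 - a\<^sup>2\<close> constant along the curve, so near \<open>t0\<close> everything can be expressed through the single
  function \<open>a\<close>: both \<open>x\<close> and \<open>b\<close> are smooth functions of \<open>a\<^sup>2\<close>, and integrating
  \<open>dz = - a\<^sup>2 / (c x b) da\<close> shows that \<open>z - z(t0)\<close> is \<open>a\<^sup>3\<close> times a non-vanishing smooth function of
  \<open>a\<^sup>2\<close>. Therefore \<open>\<gamma> = \<Psi>(a\<^sup>2, a\<^sup>3)\<close> for a local diffeomorphism \<open>\<Psi>\<close> of the plane
  (\<open>legendre_normal_form\<close>).

  The relation \<open>a a' = - c x b \<beta>\<close> forces \<open>ord \<beta> = 2 ord a - 1\<close> (\<open>order_of_beta\<close>), that is, \<open>n = 2 m\<close>.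
  Hence the order conditions for a 4/3-cusp and for a 5/3-cusp never hold, and the one for a
  3/2-cusp says that \<open>m = 0\<close>. In that case \<open>a\<close> is a local parameter and the normal form is a 3/2-cusp.

  Conversely, if \<open>\<gamma>\<close> is equivalent to \<open>(s\<^sup>i, s\<^sup>j)\<close>, then \<open>(s\<^sup>i, s\<^sup>j)\<close> and \<open>(u\<^sup>2, u\<^sup>3)\<close> are related by a
  local diffeomorphism, where \<open>u\<close> is \<open>a\<close> in the new parameter, of order \<open>m + 1\<close>. Such a map preserves
  distances up to bounded factors (\<open>A_equivalent_imp_bilipschitz\<close>). Comparing the distances to the
  origin gives \<open>i = 2 (m + 1)\<close>, which rules out \<open>i = 3\<close> and leaves \<open>m = 0\<close> for \<open>i = 2\<close>. A 5/2-cusp is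
  excluded by comparing the parameters \<open>s\<close> and \<open>-s\<close>: its two points are at distance \<open>2 \<bar>s\<bar>\<^sup>5\<close>,
  while \<open>u\<^sup>3\<close> changes by a multiple of \<open>\<bar>s\<bar>\<^sup>3\<close> (\<open>bilipschitz_powers_imp_exponents\<close>).
\<close>

section \<open>Calculus of smooth maps\<close>

lemma Ck_on_cong:
  assumes "\<And>x. x \<in> S \<Longrightarrow> f x = g x" "Ck_on k f S"
  shows "Ck_on k g S"
  using assms
proof (induction k arbitrary: f g)
  case 0
  then show ?case by (simp cong: continuous_on_cong)
next
  case (Suc k)
  have eq: "(f has_derivative D) (at x within S) \<longleftrightarrow> (g has_derivative D) (at x within S)"
    if "x \<in> S" for x D
    using Suc.prems(1) that by (metis has_derivative_transform)
  have fr: "frechet_derivative f (at x within S) = frechet_derivative g (at x within S)" if "x \<in> S" for x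
    unfolding frechet_derivative_def using eq[OF that] by simp
  have "g differentiable_on S"
    using Suc.prems eq unfolding Ck_on.simps differentiable_on_def differentiable_def by blast
  moreover have "Ck_on k (\<lambda>x. frechet_derivative g (at x within S) v) S" for v
    using Suc.IH[of "\<lambda>x. frechet_derivative f (at x within S) v" "\<lambda>x. frechet_derivative g (at x within S) v"]
      Suc.prems(2) fr by simp
  ultimately show ?case by simp
qed

lemma Ck_on_SucI:
  assumes "open S" "\<And>x. x \<in> S \<Longrightarrow> (f has_derivative D x) (at x)"
    "\<And>v. Ck_on k (\<lambda>x. D x v) S"
  shows "Ck_on (Suc k) f S"
proof -
  have w: "at x within S = at x" if "x \<in> S" for x
    using assms(1) that by (rule at_within_open[rotated])
  have "D x = frechet_derivative f (at x within S)" if "x \<in> S" for x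
    using frechet_derivative_at[OF assms(2)[OF that]] w[OF that] by simp
  then have "Ck_on k (\<lambda>x. frechet_derivative f (at x within S) v) S" for v
    using assms(3)[of v] by (rule_tac Ck_on_cong[of S "\<lambda>x. D x v"]) auto
  moreover have "f differentiable_on S"
    unfolding differentiable_on_def differentiable_def using assms(2) w by force
  ultimately show ?thesis by simp
qed

lemma Ck_on_SucE:
  assumes "open S" "Ck_on (Suc k) f S"
  obtains D where "\<And>x. x \<in> S \<Longrightarrow> (f has_derivative D x) (at x)"
    "\<And>v. Ck_on k (\<lambda>x. D x v) S"
proof
  fix x assume x: "x \<in> S"
  then have "f differentiable (at x within S)"
    using assms(2) by (simp add: differentiable_on_def)
  then show "(f has_derivative frechet_derivative f (at x within S)) (at x)"
    using at_within_open[OF x assms(1)] by (metis frechet_derivative_works)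
next
  show "Ck_on k (\<lambda>x. frechet_derivative f (at x within S) v) S" for v
    using assms(2) by simp
qed

lemma Ck_on_lower:
  assumes "Ck_on (Suc k) f S"
  shows "Ck_on k f S"
  using assms
proof (induction k arbitrary: f)
  case 0
  then show ?case by (simp add: differentiable_imp_continuous_on)
next
  case (Suc k)
  then show ?case by simp
qed

lemma Ck_on_subset:
  assumes "Ck_on k f S" "T \<subseteq> S" "open T"
  shows "Ck_on k f T"
  using assms(1)
proof (induction k arbitrary: f)
  case 0
  then show ?case using assms(2) continuous_on_subset by auto
next
  case (Suc k)
  have "frechet_derivative f (at x within S) = frechet_derivative f (at x within T)"
    if "x \<in> T" for x
    using that assms(2,3) by (metis at_within_interior at_within_open interior_maximal subsetD)
  then have "Ck_on k (\<lambda>x. frechet_derivative f (at x within T) v) T" for v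
    using Suc.IH[of "\<lambda>x. frechet_derivative f (at x within S) v"] Suc.prems
    by (rule_tac Ck_on_cong[of T "\<lambda>x. frechet_derivative f (at x within S) v"]) auto
  then show ?case
    using Suc.prems assms(2) differentiable_on_subset by auto
qed

lemma Ck_on_const: "open S \<Longrightarrow> Ck_on k (\<lambda>x. c) S"
proof (induction k arbitrary: c)
  case (Suc k)
  show ?case
    by (rule Ck_on_SucI[where D = "\<lambda>x v. 0"]) (use Suc in auto)
qed auto

lemma Ck_on_bounded_linear_compose:
  assumes "open S" "bounded_linear h" "Ck_on k f S"
  shows "Ck_on k (\<lambda>x. h (f x)) S"
  using assms(3)
proof (induction k arbitrary: f)
  case 0
  then show ?case
    using bounded_linear.continuous_on[OF assms(2)] by simp
next
  case (Suc k)
  obtain D where D: "\<And>x. x \<in> S \<Longrightarrow> (f has_derivative D x) (at x)" "\<And>v. Ck_on k (\<lambda>x. D x v) S"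
    using Ck_on_SucE[OF assms(1) Suc.prems] by blast
  show ?case
    by (rule Ck_on_SucI[OF assms(1), where D = "\<lambda>x v. h (D x v)"])
      (use bounded_linear.has_derivative[OF assms(2)] D Suc.IH in auto)
qed

lemma Ck_on_ident: "open S \<Longrightarrow> Ck_on k (\<lambda>x. x) S"
proof (cases k)
  case (Suc k)
  assume "open S"
  then show ?thesis unfolding Suc
    by (rule Ck_on_SucI[where D = "\<lambda>x v. v"]) (auto intro: Ck_on_const \<open>open S\<close>)
qed auto

lemma Ck_on_add:
  assumes "open S" "Ck_on k f S" "Ck_on k g S"
  shows "Ck_on k (\<lambda>x. f x + g x) S"
  using assms(2,3)
proof (induction k arbitrary: f g)
  case 0
  then show ?case by (simp add: continuous_on_add)
next
  case (Suc k)
  obtain D where D: "\<And>x. x \<in> S \<Longrightarrow> (f has_derivative D x) (at x)" "\<And>v. Ck_on k (\<lambda>x. D x v) S"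
    using Ck_on_SucE[OF assms(1) Suc.prems(1)] by blast
  obtain E where E: "\<And>x. x \<in> S \<Longrightarrow> (g has_derivative E x) (at x)" "\<And>v. Ck_on k (\<lambda>x. E x v) S"
    using Ck_on_SucE[OF assms(1) Suc.prems(2)] by blast
  show ?case
    by (rule Ck_on_SucI[OF assms(1), where D = "\<lambda>x v. D x v + E x v"])
      (use D E Suc.IH has_derivative_add in auto)
qed

lemma Ck_on_sum:
  assumes "open S" "\<And>i. i \<in> A \<Longrightarrow> Ck_on k (f i) S"
  shows "Ck_on k (\<lambda>x. \<Sum>i\<in>A. f i x) S"
  using assms(2)
  by (induction A rule: infinite_finite_induct) (auto intro: Ck_on_const Ck_on_add assms(1))

lemma Ck_on_scaleR:
  fixes f :: "'a::euclidean_space \<Rightarrow> real" and g :: "'a \<Rightarrow> 'b::euclidean_space"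
  assumes "open S" "Ck_on k f S" "Ck_on k g S"
  shows "Ck_on k (\<lambda>x. f x *\<^sub>R g x) S"
  using assms(2,3)
proof (induction k arbitrary: f g)
  case 0
  then show ?case by (simp add: continuous_on_scaleR)
next
  case (Suc k)
  obtain D where D: "\<And>x. x \<in> S \<Longrightarrow> (f has_derivative D x) (at x)" "\<And>v. Ck_on k (\<lambda>x. D x v) S"
    using Ck_on_SucE[OF assms(1) Suc.prems(1)] by blast
  obtain E where E: "\<And>x. x \<in> S \<Longrightarrow> (g has_derivative E x) (at x)" "\<And>v. Ck_on k (\<lambda>x. E x v) S"
    using Ck_on_SucE[OF assms(1) Suc.prems(2)] by blast
  have "((\<lambda>x. f x *\<^sub>R g x) has_derivative (\<lambda>v. f x *\<^sub>R E x v + D x v *\<^sub>R g x)) (at x)" if "x \<in> S" for x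
    using has_derivative_scaleR[OF D(1) E(1)] that by blast
  moreover have "Ck_on k (\<lambda>x. f x *\<^sub>R E x v + D x v *\<^sub>R g x) S" for v
    by (intro Ck_on_add assms(1) Suc.IH D(2) E(2) Ck_on_lower[OF Suc.prems(1)] Ck_on_lower[OF Suc.prems(2)])
  ultimately show ?case
    using assms(1) by (intro Ck_on_SucI[where D = "\<lambda>x v. f x *\<^sub>R E x v + D x v *\<^sub>R g x"])
qed

text \<open>
  The derivative of the composite, \<open>v \<mapsto> D (g x) (E x v)\<close>, is not yet an expression to which the
  induction hypothesis applies, because \<open>D (g x)\<close> is applied to a vector depending on \<open>x\<close>. Expanding
  that vector in the standard basis turns it into a finite sum of products of functions of class
  \<open>C\<^sup>k\<close>.
\<close>
lemma Ck_on_compose: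
  fixes f :: "'b::euclidean_space \<Rightarrow> 'c::euclidean_space" and g :: "'a::euclidean_space \<Rightarrow> 'b"
  assumes "open S" "open T" "Ck_on k f T" "Ck_on k g S" "g ` S \<subseteq> T"
  shows "Ck_on k (\<lambda>x. f (g x)) S"
  using assms(3,4)
proof (induction k arbitrary: f)
  case 0
  then show ?case using continuous_on_compose2[of T f S g] assms(5) by auto
next
  case (Suc k)
  obtain D where D: "\<And>x. x \<in> T \<Longrightarrow> (f has_derivative D x) (at x)" "\<And>v. Ck_on k (\<lambda>x. D x v) T"
    using Ck_on_SucE[OF assms(2) Suc.prems(1)] by blast
  obtain E where E: "\<And>x. x \<in> S \<Longrightarrow> (g has_derivative E x) (at x)" "\<And>v. Ck_on k (\<lambda>x. E x v) S"
    using Ck_on_SucE[OF assms(1) Suc.prems(2)] by blast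
  have der: "((\<lambda>x. f (g x)) has_derivative (\<lambda>v. D (g x) (E x v))) (at x)" if "x \<in> S" for x
    using has_derivative_compose[OF E(1) D(1)] that assms(5) by blast
  have exp: "D (g x) (E x v) = (\<Sum>i\<in>Basis. (E x v \<bullet> i) *\<^sub>R D (g x) i)" if "x \<in> S" for x v
  proof -
    have "linear (D (g x))"
      using D(1)[of "g x"] that assms(5) has_derivative_linear by blast
    then have "D (g x) (\<Sum>i\<in>Basis. (E x v \<bullet> i) *\<^sub>R i) = (\<Sum>i\<in>Basis. (E x v \<bullet> i) *\<^sub>R D (g x) i)"
      by (simp add: linear_sum linear_scale)
    then show ?thesis by (simp add: euclidean_representation)
  qed
  have Ck: "Ck_on k (\<lambda>x. D (g x) (E x v)) S" for v
  proof (rule Ck_on_cong)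
    show "Ck_on k (\<lambda>x. \<Sum>i\<in>Basis. (E x v \<bullet> i) *\<^sub>R D (g x) i) S"
      using E(2) Suc.IH[OF D(2) Ck_on_lower[OF Suc.prems(2)]] assms(1)
      by (intro Ck_on_sum Ck_on_scaleR Ck_on_bounded_linear_compose[of S "\<lambda>y. y \<bullet> _"]
          bounded_linear_inner_left) auto
  qed (simp add: exp)
  show ?case
    using assms(1) der Ck by (rule Ck_on_SucI[where D = "\<lambda>x v. D (g x) (E x v)"])
qed

lemma Ck_on_mult:
  fixes f g :: "'a::euclidean_space \<Rightarrow> real"
  assumes "open S" "Ck_on k f S" "Ck_on k g S"
  shows "Ck_on k (\<lambda>x. f x * g x) S"
  using Ck_on_scaleR[OF assms] by simp

text \<open>
  The derivative of the inverse is a polynomial in the inverse itself, so smoothness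
  bootstraps; the square root is treated in the same way.
\<close>
lemma Ck_on_inverse: "Ck_on k (inverse :: real \<Rightarrow> real) (- {0})"
proof (induction k)
  case 0
  have "continuous_on (- {0}) (\<lambda>x :: real. inverse x)"
    by (rule continuous_on_inverse) auto
  then show ?case by (simp only: Ck_on.simps)
next
  case (Suc k)
  have der: "(inverse has_derivative (\<lambda>v. (inverse x * inverse x) * (- v))) (at x)"
    if "x \<in> - {0}" for x :: real
    using has_derivative_inverse'[of x UNIV] that by (simp add: algebra_simps)
  have Ck: "Ck_on k (\<lambda>x. (inverse x * inverse x) * (- v)) (- {0})" for v :: real
    using Suc by (intro Ck_on_mult Ck_on_const) auto
  show ?case
    by (rule Ck_on_SucI[where D = "\<lambda>x v. (inverse x * inverse x) * (- v)", OF _ der Ck]) auto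
qed

lemma Ck_on_sqrt: "Ck_on k sqrt {0<..}"
proof (induction k)
  case 0
  have "continuous_on {0<..} sqrt"
    by (rule continuous_on_real_sqrt[OF continuous_on_id])
  then show ?case by (simp only: Ck_on.simps)
next
  case (Suc k)
  have der: "(sqrt has_derivative (\<lambda>v. inverse (sqrt x) * (v / 2))) (at x)" if "x \<in> {0<..}" for x
  proof -
    have "(sqrt has_derivative (*) (inverse (sqrt x) / 2)) (at x)"
      using DERIV_real_sqrt[of x] that by (simp only: has_field_derivative_def greaterThan_iff)
    moreover have "(*) (inverse (sqrt x) / 2) = (\<lambda>v. inverse (sqrt x) * (v / 2))"
      by auto
    ultimately show ?thesis by (simp only:)
  qed
  have "Ck_on k (\<lambda>x. inverse (sqrt x)) {0<..}"
    by (rule Ck_on_compose[of "{0<..}" "- {0}" k inverse sqrt]) (use Ck_on_inverse Suc in auto)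
  then have Ck: "Ck_on k (\<lambda>x. inverse (sqrt x) * (v / 2)) {0<..}" for v
    by (intro Ck_on_mult Ck_on_const) auto
  show ?case
    by (rule Ck_on_SucI[where D = "\<lambda>x v. inverse (sqrt x) * (v / 2)", OF _ der Ck]) auto
qed

lemma smooth_on_cong:
  assumes "\<And>x. x \<in> S \<Longrightarrow> f x = g x" "smooth_on S f"
  shows "smooth_on S g"
  using assms Ck_on_cong unfolding smooth_on_def by blast

lemma smooth_on_subset:
  assumes "smooth_on S f" "T \<subseteq> S" "open T"
  shows "smooth_on T f"
  using assms Ck_on_subset unfolding smooth_on_def by blast

lemma smooth_on_const: "open S \<Longrightarrow> smooth_on S (\<lambda>x. c)"
  by (simp add: smooth_on_def Ck_on_const)

lemma smooth_on_ident: "open S \<Longrightarrow> smooth_on S (\<lambda>x. x)"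
  by (simp add: smooth_on_def Ck_on_ident)

lemma smooth_on_bounded_linear_compose:
  "open S \<Longrightarrow> bounded_linear h \<Longrightarrow> smooth_on S f \<Longrightarrow> smooth_on S (\<lambda>x. h (f x))"
  by (simp add: smooth_on_def Ck_on_bounded_linear_compose)

lemma smooth_on_add:
  "open S \<Longrightarrow> smooth_on S f \<Longrightarrow> smooth_on S g \<Longrightarrow> smooth_on S (\<lambda>x. f x + g x)"
  by (simp add: smooth_on_def Ck_on_add)

lemma smooth_on_mult:
  fixes f g :: "'a::euclidean_space \<Rightarrow> real"
  shows "open S \<Longrightarrow> smooth_on S f \<Longrightarrow> smooth_on S g \<Longrightarrow> smooth_on S (\<lambda>x. f x * g x)"
  by (simp add: smooth_on_def Ck_on_mult)

lemma smooth_on_minus: "open S \<Longrightarrow> smooth_on S f \<Longrightarrow> smooth_on S (\<lambda>x. - f x)"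
  by (rule smooth_on_bounded_linear_compose[of S uminus]) (auto intro: bounded_linear_minus bounded_linear_ident)

lemma smooth_on_diff:
  "open S \<Longrightarrow> smooth_on S f \<Longrightarrow> smooth_on S g \<Longrightarrow> smooth_on S (\<lambda>x. f x - g x)"
  using smooth_on_add[of S f "\<lambda>x. - g x"] smooth_on_minus[of S g] by simp

lemma smooth_on_compose:
  assumes "open S" "open T" "smooth_on T f" "smooth_on S g" "g ` S \<subseteq> T"
  shows "smooth_on S (\<lambda>x. f (g x))"
  using assms by (simp add: smooth_on_def Ck_on_compose)

lemma smooth_on_inverse:
  fixes f :: "'a::euclidean_space \<Rightarrow> real"
  assumes "open S" "smooth_on S f" "\<And>x. x \<in> S \<Longrightarrow> f x \<noteq> 0"
  shows "smooth_on S (\<lambda>x. inverse (f x))"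
  by (rule smooth_on_compose[of S "- {0}" inverse]) (use assms in \<open>auto simp: smooth_on_def Ck_on_inverse\<close>)

lemma smooth_on_divide:
  fixes f g :: "'a::euclidean_space \<Rightarrow> real"
  assumes "open S" "smooth_on S f" "smooth_on S g" "\<And>x. x \<in> S \<Longrightarrow> g x \<noteq> 0"
  shows "smooth_on S (\<lambda>x. f x / g x)"
  unfolding divide_inverse by (intro smooth_on_mult smooth_on_inverse assms)

lemma smooth_on_sqrt:
  assumes "open S" "smooth_on S f" "\<And>x. x \<in> S \<Longrightarrow> f x > 0"
  shows "smooth_on S (\<lambda>x. sqrt (f x))"
  by (rule smooth_on_compose[of S "{0<..}" sqrt]) (use assms in \<open>auto simp: smooth_on_def Ck_on_sqrt\<close>)

lemma smooth_on_power:
  fixes f :: "'a::euclidean_space \<Rightarrow> real"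
  shows "open S \<Longrightarrow> smooth_on S f \<Longrightarrow> smooth_on S (\<lambda>x. f x ^ k)"
  by (induction k) (auto intro: smooth_on_const smooth_on_mult)

lemma smooth_on_fst: "open S \<Longrightarrow> smooth_on S f \<Longrightarrow> smooth_on S (\<lambda>x. fst (f x))"
  by (rule smooth_on_bounded_linear_compose[OF _ bounded_linear_fst])

lemma smooth_on_snd: "open S \<Longrightarrow> smooth_on S f \<Longrightarrow> smooth_on S (\<lambda>x. snd (f x))"
  by (rule smooth_on_bounded_linear_compose[OF _ bounded_linear_snd])

lemma smooth_on_Pair:
  assumes "open S" "smooth_on S f" "smooth_on S g"
  shows "smooth_on S (\<lambda>x. (f x, g x))"
proof -
  have "bounded_linear (\<lambda>y. (y, 0))" "bounded_linear (\<lambda>y. (0, y))"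
    by (auto intro!: bounded_linear_Pair bounded_linear_ident bounded_linear_zero)
  then have "smooth_on S (\<lambda>x. (f x, 0) + (0, g x))"
    using assms smooth_on_bounded_linear_compose[of S "\<lambda>y. (y, 0)" f]
      smooth_on_bounded_linear_compose[of S "\<lambda>y. (0, y)" g] by (intro smooth_on_add) auto
  then show ?thesis by simp
qed

lemma smooth_on_imp_continuous_on: "smooth_on S f \<Longrightarrow> continuous_on S f"
  unfolding smooth_on_def by (metis Ck_on.simps(1))

lemma smooth_on_imp_isCont: "open S \<Longrightarrow> smooth_on S f \<Longrightarrow> x \<in> S \<Longrightarrow> isCont f x"
  using smooth_on_imp_continuous_on continuous_on_eq_continuous_at by blast

lemma smooth_on_imp_has_field_derivative:
  fixes f :: "real \<Rightarrow> real"
  assumes "open S" "smooth_on S f" "x \<in> S"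
  shows "(f has_field_derivative deriv f x) (at x)"
proof -
  have "Ck_on (Suc 0) f S" using assms(2) unfolding smooth_on_def by blast
  then obtain D where "(f has_derivative D) (at x)"
    using Ck_on_SucE[OF assms(1)] assms(3) by metis
  then show ?thesis
    using DERIV_deriv_iff_real_differentiable differentiable_def by blast
qed

text \<open>
  On the line one derivative function carries all the information of the Frechet derivatives.
\<close>
lemma Ck_on_Suc_real_iff:
  fixes f f' :: "real \<Rightarrow> real"
  assumes "open S" "\<And>x. x \<in> S \<Longrightarrow> (f has_field_derivative f' x) (at x)"
  shows "Ck_on (Suc k) f S \<longleftrightarrow> Ck_on k f' S"
proof
  assume "Ck_on (Suc k) f S"
  then obtain D where D: "\<And>x. x \<in> S \<Longrightarrow> (f has_derivative D x) (at x)" "\<And>v. Ck_on k (\<lambda>x. D x v) S"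
    using Ck_on_SucE[OF assms(1)] by blast
  have "D x 1 = f' x" if "x \<in> S" for x
    using has_derivative_unique[OF D(1)[OF that] assms(2)[OF that, unfolded has_field_derivative_def]] by simp
  then show "Ck_on k f' S" using Ck_on_cong[of S "\<lambda>x. D x 1" f'] D(2) by blast
next
  assume f': "Ck_on k f' S"
  show "Ck_on (Suc k) f S"
    by (rule Ck_on_SucI[where D = "\<lambda>x v. f' x * v"])
      (use assms f' in \<open>auto simp: has_field_derivative_def intro!: Ck_on_mult Ck_on_const\<close>)
qed

lemma smooth_on_deriv:
  fixes f :: "real \<Rightarrow> real"
  assumes "open S" "smooth_on S f"
  shows "smooth_on S (deriv f)"
  using Ck_on_Suc_real_iff[OF assms(1) smooth_on_imp_has_field_derivative[OF assms]] assms(2)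
  unfolding smooth_on_def by blast

lemmas smooth_on_intros = smooth_on_const smooth_on_ident smooth_on_add smooth_on_mult
  smooth_on_minus smooth_on_diff smooth_on_inverse smooth_on_divide smooth_on_sqrt smooth_on_power
  smooth_on_fst smooth_on_snd smooth_on_Pair

lemma diffeomorphismI:
  assumes "open U" "open V" "smooth_on U f" "smooth_on V g"
    "\<And>x. x \<in> U \<Longrightarrow> f x \<in> V \<and> g (f x) = x" "\<And>y. y \<in> V \<Longrightarrow> g y \<in> U \<and> f (g y) = y"
  shows "diffeomorphism U V f g"
  unfolding diffeomorphism_def
  by (intro conjI homeomorphismI smooth_on_imp_continuous_on assms) (use assms in blast)+

text \<open>
  The same bootstrap as for the reciprocal: \<open>g' = 1 / (f' \<circ> g)\<close> is as often differentiable as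
  \<open>g\<close> is.
\<close>
lemma smooth_on_inverse_function:
  fixes f g :: "real \<Rightarrow> real"
  assumes "open U" "open V" "smooth_on U f" "continuous_on V g" "g ` V \<subseteq> U"
    and fg: "\<And>y. y \<in> V \<Longrightarrow> f (g y) = y" and nz: "\<And>x. x \<in> U \<Longrightarrow> deriv f x \<noteq> 0"
  shows "smooth_on V g"
proof -
  have der: "(g has_field_derivative inverse (deriv f (g y))) (at y)" if y: "y \<in> V" for y
  proof -
    obtain e where e: "e > 0" "ball y e \<subseteq> V"
      using assms(2) y by (meson openE)
    have "{y - e<..<y + e} \<subseteq> V" using e(2) by (simp add: ball_eq_greaterThanLessThan)
    then have "f (g w) = w" if "y - e < w" "w < y + e" for w
      using fg that by auto
    moreover have "isCont g y" using assms(2,4) y continuous_on_eq_continuous_at by blast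
    moreover have "(f has_field_derivative deriv f (g y)) (at (g y))" "deriv f (g y) \<noteq> 0"
      using smooth_on_imp_has_field_derivative[OF assms(1,3)] assms(5) y nz by auto
    ultimately show ?thesis
      using DERIV_inverse_function[of f "deriv f (g y)" g y "y - e" "y + e"] e(1) by auto
  qed
  have inv: "smooth_on U (\<lambda>x. inverse (deriv f x))"
    by (intro smooth_on_inverse smooth_on_deriv assms nz)
  have "Ck_on k g V" for k
  proof (induction k)
    case 0
    then show ?case using assms by simp
  next
    case (Suc k)
    have "Ck_on k (\<lambda>y. inverse (deriv f (g y))) V"
      by (rule Ck_on_compose[OF assms(2,1) _ Suc assms(5)]) (use inv in \<open>simp add: smooth_on_def\<close>)
    then show ?case using Ck_on_Suc_real_iff[OF assms(2) der] by blast
  qed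
  then show ?thesis by (simp add: smooth_on_def)
qed

text \<open>
  Near \<open>p\<close> the derivative does not vanish, so \<open>f\<close> is injective by Rolle's theorem, and its image is open
  by invariance of domain.
\<close>
lemma local_diffeomorphism_real:
  fixes f :: "real \<Rightarrow> real"
  assumes "open S" "smooth_on S f" "p \<in> S" "deriv f p \<noteq> 0"
  obtains U V g where "diffeomorphism U V f g" "p \<in> U" "U \<subseteq> S"
proof -
  have "isCont (deriv f) p"
    using smooth_on_imp_isCont smooth_on_deriv assms by blast
  then have "\<forall>\<^sub>F x in nhds p. deriv f x \<noteq> 0"
    using assms(4) tendsto_imp_eventually_ne[of "deriv f" "deriv f p" "at p" 0]
    by (simp add: isCont_def eventually_nhds_conv_at)
  then have "\<forall>\<^sub>F x in nhds p. deriv f x \<noteq> 0 \<and> x \<in> S"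
    using assms(1,3) by (simp add: eventually_conj eventually_nhds_in_open)
  then obtain e where e: "e > 0" "\<And>x. x \<in> ball p e \<Longrightarrow> deriv f x \<noteq> 0 \<and> x \<in> S"
    unfolding eventually_nhds_metric by (auto simp: dist_commute)
  define U where "U = ball p e"
  have U: "open U" "U \<subseteq> S" "p \<in> U" using e by (auto simp: U_def)
  have f: "smooth_on U f" using smooth_on_subset[OF assms(2)] U by blast
  have cont: "continuous_on U f" using smooth_on_imp_continuous_on f by blast
  have ne: "f x \<noteq> f y" if "x < y" "x \<in> U" "y \<in> U" for x y
  proof
    assume eq: "f x = f y"
    have sub: "{x..y} \<subseteq> U" using that by (auto simp: U_def dist_real_def)
    have der: "(f has_field_derivative deriv f w) (at w)" if "w \<in> {x..y}" for w
      using sub that smooth_on_imp_has_field_derivative[OF U(1) f] by blast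
    then have "f differentiable (at w)" if "x < w" "w < y" for w
      using that unfolding real_differentiable_def by (meson atLeastAtMost_iff less_imp_le)
    then have "\<exists>w>x. w < y \<and> (f has_field_derivative 0) (at w)"
      by (rule Rolle[OF that(1) eq continuous_on_subset[OF cont sub]])
    then obtain w where "x < w" "w < y" "(f has_field_derivative 0) (at w)" by blast
    moreover have "w \<in> U" using sub \<open>x < w\<close> \<open>w < y\<close> by auto
    ultimately show False using e(2)[of w] DERIV_imp_deriv[of f 0 w] by (simp add: U_def)
  qed
  have inj: "inj_on f U"
    by (rule inj_onI) (metis ne linorder_neqE_linordered_idom)
  obtain g where g: "homeomorphism U (f ` U) f g"
    using invariance_of_domain_homeomorphism[OF U(1) cont _ inj] by auto
  have V: "open (f ` U)" using invariance_of_domain[OF cont U(1) inj] .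
  have "smooth_on (f ` U) g"
    by (rule smooth_on_inverse_function[OF U(1) V f])
      (use g e(2) in \<open>auto simp: homeomorphism_def U_def\<close>)
  then show ?thesis
    using that[of U "f ` U" g] U V g f by (simp add: diffeomorphism_def)
qed

section \<open>Moments of smooth functions\<close>

text \<open>
  Substituting \<open>u = s v\<close>, the integral of \<open>u\<^sup>p f(u\<^sup>2)\<close> over \<open>[0, s]\<close> is
  \<open>s\<^bsup>p + 1\<^esup>\<close> times the moment at \<open>s\<^sup>2\<close>. In this form it is visibly smooth in \<open>w = s\<^sup>2\<close>, also at the origin.
\<close>
definition moment :: "nat \<Rightarrow> (real \<Rightarrow> real) \<Rightarrow> real \<Rightarrow> real" where
  "moment p f w = integral {0..1} (\<lambda>v. v ^ p * f (w * v\<^sup>2))"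

text \<open>
  Keeps the arguments \<open>w * v\<^sup>2\<close> of the integrand below inside the interval on which \<open>f\<close> is smooth.
\<close>
lemma mult_square_unit_mem:
  fixes w v r :: real
  assumes "w \<in> {-r<..<r}" "v \<in> {0..1}"
  shows "w * v\<^sup>2 \<in> {-r<..<r}"
proof -
  have "v\<^sup>2 \<le> 1" "0 \<le> v\<^sup>2" using assms(2) by (auto simp: power_le_one)
  then have "\<bar>w * v\<^sup>2\<bar> \<le> \<bar>w\<bar>"
    by (simp add: abs_mult mult_left_le)
  then show ?thesis using assms(1) by auto
qed

text \<open>
  Differentiation under the integral sign yields a moment of the derivative, so that moments of
  smooth functions are smooth by induction.
\<close>
lemma has_field_derivative_moment:
  fixes f :: "real \<Rightarrow> real"
  assumes f: "smooth_on {-r<..<r} f" and w: "w \<in> {-r<..<r}"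
  shows "(moment p f has_field_derivative moment (p + 2) (deriv f) w) (at w)"
proof -
  define U where "U = {-r<..<r}"
  have U: "open U" "convex U" "w \<in> U" using w by (auto simp: U_def)
  have fU: "smooth_on U f" "smooth_on U (deriv f)"
    using f smooth_on_deriv[OF U(1)] by (simp_all add: U_def)
  note mem = mult_square_unit_mem[of _ r, folded U_def]
  have "((\<lambda>x. integral (cbox 0 1) (\<lambda>v. v ^ p * f (x * v\<^sup>2))) has_field_derivative
      integral (cbox 0 1) (\<lambda>v. v ^ (p + 2) * deriv f (w * v\<^sup>2))) (at w within U)"
  proof (rule leibniz_rule_field_derivative[OF _ _ _ U(3,2)])
    fix x v :: real assume x: "x \<in> U" and v: "v \<in> cbox 0 1"
    then have "(f has_field_derivative deriv f (x * v\<^sup>2)) (at (x * v\<^sup>2))"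
      using smooth_on_imp_has_field_derivative[OF U(1) fU(1)] mem by auto
    then have "((\<lambda>x. f (x * v\<^sup>2)) has_field_derivative deriv f (x * v\<^sup>2) * v\<^sup>2) (at x within U)"
      by (rule DERIV_chain2) (auto intro!: derivative_eq_intros)
    then show "((\<lambda>x. v ^ p * f (x * v\<^sup>2)) has_field_derivative v ^ (p + 2) * deriv f (x * v\<^sup>2)) (at x within U)"
      by (rule DERIV_cong[OF DERIV_cmult[of _ _ _ _ "v ^ p"]]) (simp add: power_add power2_eq_square)
  next
    fix x :: real assume "x \<in> U"
    then show "(\<lambda>v. v ^ p * f (x * v\<^sup>2)) integrable_on cbox 0 1"
      using mem by (intro integrable_continuous continuous_intros
          continuous_on_compose2[OF smooth_on_imp_continuous_on[OF fU(1)]]) auto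
  next
    show "continuous_on (U \<times> cbox 0 1) (\<lambda>(x, v). v ^ (p + 2) * deriv f (x * v\<^sup>2))"
      unfolding split_beta using mem by (intro continuous_intros
          continuous_on_compose2[OF smooth_on_imp_continuous_on[OF fU(2)]]) auto
  qed
  then show ?thesis
    using at_within_open[OF U(3,1)] by (simp add: moment_def[abs_def])
qed

lemma smooth_on_moment:
  fixes f :: "real \<Rightarrow> real"
  assumes "smooth_on {-r<..<r} f"
  shows "smooth_on {-r<..<r} (moment p f)"
proof -
  have "Ck_on k (moment p f) {-r<..<r}" for k
    using assms
  proof (induction k arbitrary: f p)
    case 0
    have "isCont (moment p f) w" if "w \<in> {-r<..<r}" for w
      by (rule DERIV_isCont[OF has_field_derivative_moment[OF 0 that]])
    then show ?case by (simp add: continuous_at_imp_continuous_on)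
  next
    case (Suc k)
    have "Ck_on k (moment (p + 2) (deriv f)) {-r<..<r}"
      by (rule Suc.IH[OF smooth_on_deriv[OF _ Suc.prems]]) auto
    then show ?case
      using Ck_on_Suc_real_iff[OF _ has_field_derivative_moment[OF Suc.prems]]
      by (metis open_greaterThanLessThan)
  qed
  then show ?thesis by (simp add: smooth_on_def)
qed

text \<open>
  Integrate the derivative of \<open>v\<^sup>3 f(w v\<^sup>2)\<close> over \<open>[0, 1]\<close>. The identity says that
  \<open>S(s) = s\<^sup>3 H(s\<^sup>2)\<close>, with \<open>H\<close> the second moment of \<open>f\<close>, satisfies \<open>S'(s) = s\<^sup>2 f(s\<^sup>2)\<close>: the primitive
  of such a function is \<open>s\<^sup>3\<close> times a smooth function of \<open>s\<^sup>2\<close>.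
\<close>
lemma moment_differential_equation:
  fixes f :: "real \<Rightarrow> real"
  assumes f: "smooth_on {-r<..<r} f" and w: "w \<in> {-r<..<r}"
  shows "3 * moment 2 f w + 2 * w * moment 4 (deriv f) w = f w"
proof -
  note mem = mult_square_unit_mem[OF w]
  have f': "smooth_on {-r<..<r} (deriv f)" by (rule smooth_on_deriv[OF _ f]) auto
  have "((\<lambda>v. v ^ 3 * f (w * v\<^sup>2)) has_field_derivative
      3 * (v\<^sup>2 * f (w * v\<^sup>2)) + 2 * w * (v ^ 4 * deriv f (w * v\<^sup>2))) (at v within {0..1})"
    if v: "v \<in> {0..1}" for v
  proof -
    have "(f has_field_derivative deriv f (w * v\<^sup>2)) (at (w * v\<^sup>2))"
      using smooth_on_imp_has_field_derivative[OF _ f mem[OF v]] by auto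
    then have "((\<lambda>v. f (w * v\<^sup>2)) has_field_derivative deriv f (w * v\<^sup>2) * (w * (2 * v))) (at v within {0..1})"
      by (rule DERIV_chain2) (auto intro!: derivative_eq_intros)
    then have "((\<lambda>v. v ^ 3 * f (w * v\<^sup>2)) has_field_derivative
        3 * v\<^sup>2 * f (w * v\<^sup>2) + deriv f (w * v\<^sup>2) * (w * (2 * v)) * v ^ 3) (at v within {0..1})"
      by (intro DERIV_mult) (auto intro!: derivative_eq_intros)
    moreover have "v * v ^ 3 = v ^ 4" by (simp add: power_Suc[symmetric])
    then have "deriv f (w * v\<^sup>2) * (w * (2 * v)) * v ^ 3 = 2 * w * (v ^ 4 * deriv f (w * v\<^sup>2))"
      by (metis mult.assoc mult.commute)
    ultimately show ?thesis by (simp only: mult.assoc)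
  qed
  then have ftc: "((\<lambda>v. 3 * (v\<^sup>2 * f (w * v\<^sup>2)) + 2 * w * (v ^ 4 * deriv f (w * v\<^sup>2))) has_integral
      (1 ^ 3 * f (w * 1\<^sup>2) - 0 ^ 3 * f (w * 0\<^sup>2))) {0..1}"
    by (intro fundamental_theorem_of_calculus) (auto simp: has_real_derivative_iff_has_vector_derivative)
  have moments: "((\<lambda>v. v ^ p * g (w * v\<^sup>2)) has_integral moment p g w) {0..1}"
    if "smooth_on {-r<..<r} g" for p g
    unfolding moment_def using mem
    by (intro integrable_integral integrable_continuous_real continuous_intros
        continuous_on_compose2[OF smooth_on_imp_continuous_on[OF that]]) auto
  then have "((\<lambda>v. 3 * (v\<^sup>2 * f (w * v\<^sup>2)) + 2 * w * (v ^ 4 * deriv f (w * v\<^sup>2))) has_integral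
      (3 * moment 2 f w + 2 * w * moment 4 (deriv f) w)) {0..1}"
    by (intro has_integral_add has_integral_mult_right moments f f')
  from has_integral_unique[OF this ftc] show ?thesis by simp
qed

section \<open>Normal form of the profile curve\<close>

lemma DERIV_zero_ball_imp_eq_centre:
  fixes f :: "real \<Rightarrow> real"
  assumes der: "\<And>s. s \<in> ball p d \<Longrightarrow> (f has_field_derivative 0) (at s)" and t: "t \<in> ball p d"
  shows "f t = f p"
proof -
  have "\<exists>C. \<forall>s\<in>ball p d. f s = C"
    by (rule has_field_derivative_zero_constant[OF convex_ball])
      (rule has_field_derivative_at_within[OF der])
  moreover have "p \<in> ball p d" using t by (metis centre_in_ball ball_empty empty_iff not_le)
  ultimately show ?thesis using t by metis
qed

text \<open>
  Near \<open>t0\<close> the profile is a fixed local diffeomorphism of the plane applied to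
  \<open>(a\<^sup>2, a\<^sup>3)\<close>, whatever the order of \<open>a\<close> is. The Gauss curvature equation makes
  \<open>c x\<^sup>2 - a\<^sup>2\<close> a first integral, so \<open>x\<close> is a smooth function \<open>X\<close> of \<open>a\<^sup>2\<close>, and so is \<open>b\<close> because
  \<open>a\<^sup>2 + b\<^sup>2 = 1\<close>. Moreover \<open>dz = \<beta> a dt = - a\<^sup>2 / (c x b) da\<close>, whose coefficient is \<open>a\<^sup>2\<close> times a
  function \<open>f\<close> of \<open>a\<^sup>2\<close>. Hence \<open>z - z(t0) = a\<^sup>3 H(a\<^sup>2)\<close> with \<open>H\<close> a moment of \<open>f\<close>, and
  \<open>H(0) = f(0) / 3 \<noteq> 0\<close> makes \<open>(w, y) \<mapsto> (X(w), z(t0) + y H(w))\<close> invertible near the origin.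
\<close>
lemma legendre_normal_form:
  fixes x z a b l \<beta> :: "real \<Rightarrow> real"
  assumes T: "open T" "t0 \<in> T"
    and dx: "\<And>t. t \<in> T \<Longrightarrow> (x has_field_derivative - \<beta> t * b t) (at t)"
    and dz: "\<And>t. t \<in> T \<Longrightarrow> (z has_field_derivative \<beta> t * a t) (at t)"
    and da: "\<And>t. t \<in> T \<Longrightarrow> (a has_field_derivative - l t * b t) (at t)"
    and db: "\<And>t. t \<in> T \<Longrightarrow> (b has_field_derivative l t * a t) (at t)"
    and unit: "\<And>t. t \<in> T \<Longrightarrow> (a t)\<^sup>2 + (b t)\<^sup>2 = 1"
    and K: "\<And>t. t \<in> T \<Longrightarrow> a t * l t = c * \<beta> t * x t"
    and nz: "c \<noteq> 0" "x t0 \<noteq> 0" and a0: "a t0 = 0"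
  obtains U V \<Phi> \<Psi> where "diffeomorphism U V \<Phi> \<Psi>" "(x t0, z t0) \<in> U"
    "\<forall>\<^sub>F t in nhds t0. (x t, z t) \<in> U \<and> \<Phi> (x t, z t) = (a t ^ 2, a t ^ 3)"
proof -
  define x0 z0 b0 where "x0 = x t0" "z0 = z t0" "b0 = b t0"
  have x0: "x0 \<noteq> 0" and b0: "b0\<^sup>2 = 1"
    using nz unit[OF T(2)] a0 by (auto simp: x0_z0_b0_def)
  then have b0n: "b0 \<noteq> 0" by auto
  \<comment> \<open>for \<open>\<bar>w\<bar> < R\<close> both radicands \<open>1 - w\<close> and \<open>1 + w / (c x0\<^sup>2)\<close> are positive\<close>
  define R where "R = min 1 (\<bar>c\<bar> * x0\<^sup>2)"
  have R: "R > 0" using nz x0 by (simp add: R_def)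
  have pos: "1 - w > 0" "1 + w / (c * x0\<^sup>2) > 0" if "w \<in> {-R<..<R}" for w
  proof -
    show "1 - w > 0" using that by (simp add: R_def)
    have "\<bar>w\<bar> < \<bar>c * x0\<^sup>2\<bar>" using that by (auto simp: R_def abs_mult)
    then have "\<bar>w / (c * x0\<^sup>2)\<bar> < 1" using nz x0 by (simp add: abs_divide)
    then show "1 + w / (c * x0\<^sup>2) > 0" by linarith
  qed
  define X where "X = (\<lambda>w. x0 * sqrt (1 + w / (c * x0\<^sup>2)))"
  define B where "B = (\<lambda>w. b0 * sqrt (1 - w))"
  define f where "f = (\<lambda>w. - 1 / (c * X w * B w))"
  have XB: "X w \<noteq> 0" "B w \<noteq> 0" if "w \<in> {-R<..<R}" for w
    using pos[OF that] x0 b0n by (auto simp: X_def B_def)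
  have sX: "smooth_on {-R<..<R} X"
    unfolding X_def using pos nz x0 by (intro smooth_on_intros) auto
  have sf: "smooth_on {-R<..<R} f"
    unfolding f_def using XB nz pos
    by (intro smooth_on_intros sX) (auto simp: B_def intro!: smooth_on_intros)
  define H where "H = moment 2 f"
  have sH: "smooth_on {-R<..<R} H"
    unfolding H_def by (rule smooth_on_moment[OF sf])
  have "H 0 \<noteq> 0"
    using moment_differential_equation[OF sf, of 0] R XB[of 0] nz by (auto simp: H_def f_def)
  moreover have "isCont H 0"
    using smooth_on_imp_isCont[OF _ sH] R by auto
  ultimately have "\<forall>\<^sub>F w in nhds 0. H w \<noteq> 0"
    using tendsto_imp_eventually_ne[of H "H 0" "at 0" 0]
    by (simp add: isCont_def eventually_nhds_conv_at)
  then obtain e where e: "e > 0" "\<And>w. \<bar>w\<bar> < e \<Longrightarrow> H w \<noteq> 0"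
    unfolding eventually_nhds_metric by (auto simp: dist_real_def)
  define r where "r = min e R"
  define W where "W = {-r<..<r}"
  have r: "r > 0" using e R by (simp add: r_def)
  have W: "open W" "W \<subseteq> {-R<..<R}" "0 \<in> W" "\<And>w. w \<in> W \<Longrightarrow> H w \<noteq> 0"
    using e R by (auto simp: W_def r_def)
  have sXW: "smooth_on W X" and sHW: "smooth_on W H"
    using smooth_on_subset[OF _ W(2,1)] sX sH by auto
  define U V where "U = {p :: real \<times> real. fst p * x0 > 0 \<and> c * ((fst p)\<^sup>2 - x0\<^sup>2) \<in> W}"
    and "V = W \<times> (UNIV :: real set)"
  define \<Phi> where "\<Phi> = (\<lambda>p :: real \<times> real. (c * ((fst p)\<^sup>2 - x0\<^sup>2), (snd p - z0) / H (c * ((fst p)\<^sup>2 - x0\<^sup>2))))"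
  define \<Psi> where "\<Psi> = (\<lambda>q :: real \<times> real. (X (fst q), z0 + snd q * H (fst q)))"
  have oU: "open U"
    unfolding U_def Collect_conj_eq
    by (intro open_Int open_Collect_less continuous_intros open_vimage[OF W(1), unfolded vimage_def])
  have oV: "open V" unfolding V_def by (intro open_Times W(1)) auto
  have X_inv: "X (c * (p\<^sup>2 - x0\<^sup>2)) = p" if "p * x0 > 0" for p
  proof -
    have "1 + c * (p\<^sup>2 - x0\<^sup>2) / (c * x0\<^sup>2) = (p / x0)\<^sup>2"
      using nz x0 by (simp add: field_simps)
    moreover have "p / x0 > 0" using that by (simp add: zero_less_divide_iff zero_less_mult_iff)
    then have "sqrt ((p / x0)\<^sup>2) = p / x0" by (intro real_sqrt_unique) auto
    ultimately show ?thesis using x0 by (simp only: X_def) simp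
  qed
  have X_sq: "c * ((X w)\<^sup>2 - x0\<^sup>2) = w" "X w * x0 > 0" if "w \<in> W" for w
  proof -
    have p: "1 + w / (c * x0\<^sup>2) > 0" using that W(2) pos by blast
    then have "(X w)\<^sup>2 = x0\<^sup>2 * (1 + w / (c * x0\<^sup>2))"
      by (simp add: X_def power_mult_distrib)
    also have "\<dots> = x0\<^sup>2 + w / c" using nz x0 by (simp add: field_simps)
    finally show "c * ((X w)\<^sup>2 - x0\<^sup>2) = w" using nz x0 by (simp add: field_simps)
    have "X w * x0 = x0\<^sup>2 * sqrt (1 + w / (c * x0\<^sup>2))" by (simp add: X_def power2_eq_square)
    then show "X w * x0 > 0" using p x0 by simp
  qed
  have U\<Phi>: "\<Phi> p \<in> V \<and> \<Psi> (\<Phi> p) = p" if "p \<in> U" for p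
    using that X_inv W(4) by (auto simp: U_def V_def \<Phi>_def \<Psi>_def)
  have V\<Psi>: "\<Psi> q \<in> U \<and> \<Phi> (\<Psi> q) = q" if "q \<in> V" for q
    using that X_sq W(4) by (auto simp: U_def V_def \<Phi>_def \<Psi>_def)
  have s\<Phi>: "smooth_on U \<Phi>"
    unfolding \<Phi>_def using W oU
    by (intro smooth_on_intros smooth_on_compose[OF oU W(1) sHW]) (auto simp: U_def)
  have s\<Psi>: "smooth_on V \<Psi>"
    unfolding \<Psi>_def using W oV
    by (intro smooth_on_intros smooth_on_compose[OF oV W(1) sHW] smooth_on_compose[OF oV W(1) sXW])
      (auto simp: V_def)
  have dif: "diffeomorphism U V \<Phi> \<Psi>"
    using oU oV s\<Phi> s\<Psi> U\<Phi> V\<Psi> by (rule diffeomorphismI)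
  have ev: "\<forall>\<^sub>F t in nhds t0. t \<in> T \<and> x t * x0 > 0 \<and> b t * b0 > 0 \<and> a t ^ 2 < r"
  proof (intro eventually_conj)
    have c: "(x \<longlongrightarrow> x0) (nhds t0)" "(b \<longlongrightarrow> b0) (nhds t0)" "(a \<longlongrightarrow> a t0) (nhds t0)"
      using DERIV_isCont[OF dx[OF T(2)]] DERIV_isCont[OF db[OF T(2)]] DERIV_isCont[OF da[OF T(2)]]
      by (simp_all add: x0_z0_b0_def tendsto_at_iff_tendsto_nhds isCont_def)
    show "\<forall>\<^sub>F t in nhds t0. t \<in> T" using T by (simp add: eventually_nhds_in_open)
    show "\<forall>\<^sub>F t in nhds t0. x t * x0 > 0"
      by (rule order_tendstoD(1)[OF tendsto_mult[OF c(1) tendsto_const]])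
        (use x0 in \<open>simp add: power2_eq_square[symmetric]\<close>)
    show "\<forall>\<^sub>F t in nhds t0. b t * b0 > 0"
      by (rule order_tendstoD(1)[OF tendsto_mult[OF c(2) tendsto_const]])
        (use b0n in \<open>simp add: power2_eq_square[symmetric]\<close>)
    show "\<forall>\<^sub>F t in nhds t0. a t ^ 2 < r"
      by (rule order_tendstoD(2)[OF tendsto_power[OF c(3), of 2]]) (use r a0 in simp)
  qed
  then obtain d where d: "d > 0" and near: "\<And>t. t \<in> ball t0 d \<Longrightarrow>
      t \<in> T \<and> x t * x0 > 0 \<and> b t * b0 > 0 \<and> a t ^ 2 < r"
    unfolding eventually_nhds_metric by (auto simp: dist_commute)
  have t0: "t0 \<in> ball t0 d" using d by simp
  have x_eq: "c * ((x t)\<^sup>2 - x0\<^sup>2) = (a t)\<^sup>2" if t: "t \<in> ball t0 d" for t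
  proof -
    have "((\<lambda>t. c * (x t)\<^sup>2 - (a t)\<^sup>2) has_field_derivative 0) (at s)"
      if s: "s \<in> ball t0 d" for s
    proof -
      have sT: "s \<in> T" using near s by blast
      have "((\<lambda>t. c * (x t)\<^sup>2 - (a t)\<^sup>2) has_field_derivative
          c * (2 * x s * (- \<beta> s * b s)) - 2 * a s * (- l s * b s)) (at s)"
        by (rule derivative_eq_intros dx[OF sT] da[OF sT] refl | simp)+
      moreover have "c * (2 * x s * (- \<beta> s * b s)) - 2 * a s * (- l s * b s) =
          2 * b s * (a s * l s - c * \<beta> s * x s)" by algebra
      then have "c * (2 * x s * (- \<beta> s * b s)) - 2 * a s * (- l s * b s) = 0"
        using K[OF sT] by simp
      ultimately show ?thesis by metis
    qed
    then have "c * (x t)\<^sup>2 - (a t)\<^sup>2 = c * (x t0)\<^sup>2 - (a t0)\<^sup>2"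
      using DERIV_zero_ball_imp_eq_centre[of t0 d "\<lambda>t. c * (x t)\<^sup>2 - (a t)\<^sup>2" t] t by blast
    then show ?thesis using a0 by (simp add: x0_z0_b0_def algebra_simps)
  qed
  have aW: "(a t)\<^sup>2 \<in> W" if t: "t \<in> ball t0 d" for t
  proof -
    have "- r < (a t)\<^sup>2" using r zero_le_power2[of "a t"] by linarith
    then show ?thesis using near[OF t] by (simp add: W_def)
  qed
  have X_a: "X ((a t)\<^sup>2) = x t" if t: "t \<in> ball t0 d" for t
    using X_inv[of "x t"] x_eq[OF t] near[OF t] by simp
  have B_a: "B ((a t)\<^sup>2) = b t" if t: "t \<in> ball t0 d" for t
  proof -
    have "1 - (a t)\<^sup>2 = (b t)\<^sup>2" using unit near[OF t] by (simp add: algebra_simps)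
    moreover have "(b0 * \<bar>b t\<bar>) = b t"
    proof -
      have "b0 = 1 \<or> b0 = -1" using b0 by (simp add: power2_eq_1_iff)
      then show ?thesis using near[OF t] by auto
    qed
    ultimately show ?thesis by (simp add: B_def)
  qed
  have z_eq: "z t = z0 + (a t) ^ 3 * H ((a t)\<^sup>2)" if t: "t \<in> ball t0 d" for t
  proof -
    have "((\<lambda>t. z t - (a t) ^ 3 * H ((a t)\<^sup>2)) has_field_derivative 0) (at s)"
      if s: "s \<in> ball t0 d" for s
    proof -
      have sT: "s \<in> T" using near s by blast
      have w: "(a s)\<^sup>2 \<in> {-R<..<R}" using aW[OF s] W(2) by blast
      define D where "D = moment 4 (deriv f) ((a s)\<^sup>2)"
      have "(H has_field_derivative D) (at ((a s)\<^sup>2))"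
        using has_field_derivative_moment[OF sf w, of 2] by (simp add: H_def D_def)
      moreover have "((\<lambda>t. (a t)\<^sup>2) has_field_derivative 2 * a s * (- l s * b s)) (at s)"
        by (rule derivative_eq_intros da[OF sT] refl | simp)+
      ultimately have "((\<lambda>t. H ((a t)\<^sup>2)) has_field_derivative D * (2 * a s * (- l s * b s))) (at s)"
        by (rule DERIV_chain2)
      from DERIV_diff[OF dz[OF sT] DERIV_mult[OF DERIV_power[OF da[OF sT], of 3] this]]
      have "((\<lambda>t. z t - (a t) ^ 3 * H ((a t)\<^sup>2)) has_field_derivative
          \<beta> s * a s + l s * b s * (a s)\<^sup>2 * (3 * H ((a s)\<^sup>2) + 2 * (a s)\<^sup>2 * D)) (at s)"
        by (rule DERIV_cong) (simp add: algebra_simps power2_eq_square power3_eq_cube)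
      moreover have "3 * H ((a s)\<^sup>2) + 2 * (a s)\<^sup>2 * D = f ((a s)\<^sup>2)"
        using moment_differential_equation[OF sf w] by (simp add: H_def D_def)
      moreover have "\<beta> s * a s + l s * b s * (a s)\<^sup>2 * f ((a s)\<^sup>2) = 0"
      proof -
        have "x s \<noteq> 0" "b s \<noteq> 0" using near[OF s] by auto
        moreover have "l s * b s * (a s)\<^sup>2 = (c * \<beta> s * x s) * (a s * b s)"
          using K[OF sT] by (simp add: power2_eq_square algebra_simps)
        ultimately show ?thesis
          using nz X_a[OF s] B_a[OF s] by (simp add: f_def)
      qed
      ultimately show ?thesis by metis
    qed
    then have "z t - (a t) ^ 3 * H ((a t)\<^sup>2) = z t0 - (a t0) ^ 3 * H ((a t0)\<^sup>2)"
      using DERIV_zero_ball_imp_eq_centre[of t0 d "\<lambda>t. z t - (a t) ^ 3 * H ((a t)\<^sup>2)" t] t by blast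
    then show ?thesis using a0 by (simp add: x0_z0_b0_def)
  qed
  show ?thesis
  proof (rule that[OF dif])
    have main: "(x t, z t) \<in> U \<and> \<Phi> (x t, z t) = ((a t)\<^sup>2, (a t) ^ 3)" if t: "t \<in> ball t0 d" for t
      using near[OF t] x_eq[OF t] aW[OF t] z_eq[OF t] W(4) by (auto simp: U_def \<Phi>_def)
    show "(x t0, z t0) \<in> U" using main[OF t0] by blast
    show "\<forall>\<^sub>F t in nhds t0. (x t, z t) \<in> U \<and> \<Phi> (x t, z t) = ((a t)\<^sup>2, (a t) ^ 3)"
      using main d unfolding eventually_nhds_metric by (auto simp: dist_commute)
  qed
qed

section \<open>Metric consequences of equivalence\<close>

text \<open>
  The partial derivatives are continuous, hence bounded near \<open>p\<close>, and they bound the operator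
  norm of the derivative.
\<close>
lemma smooth_on_imp_locally_lipschitz:
  assumes "open U" "smooth_on U f" "p \<in> U"
  obtains L e where "e > 0" "L-lipschitz_on (ball p e) f"
proof -
  have "Ck_on (Suc 0) f U" using assms(2) unfolding smooth_on_def by blast
  then obtain D where D: "\<And>x. x \<in> U \<Longrightarrow> (f has_derivative D x) (at x)"
    and "\<And>v. Ck_on 0 (\<lambda>x. D x v) U"
    by (rule Ck_on_SucE[OF assms(1)]) blast
  then have D_cont: "continuous_on U (\<lambda>x. D x v)" for v by simp
  define N where "N = (\<lambda>x. \<Sum>i\<in>Basis. norm (D x i))"
  have "continuous_on U N" unfolding N_def by (intro continuous_intros D_cont)
  then have "(N \<longlongrightarrow> N p) (nhds p)"
    using assms(1,3) by (simp add: continuous_on_eq_continuous_at isCont_def tendsto_at_iff_tendsto_nhds)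
  then have "\<forall>\<^sub>F x in nhds p. N x < N p + 1" by (rule order_tendstoD) simp
  moreover have "\<forall>\<^sub>F x in nhds p. x \<in> U" using assms by (simp add: eventually_nhds_in_open)
  ultimately have "\<forall>\<^sub>F x in nhds p. N x < N p + 1 \<and> x \<in> U" by (rule eventually_conj)
  then obtain e where e: "e > 0" "\<And>x. x \<in> ball p e \<Longrightarrow> N x < N p + 1 \<and> x \<in> U"
    unfolding eventually_nhds_metric by (auto simp: dist_commute)
  have "(N p + 1)-lipschitz_on (ball p e) f"
  proof (rule lipschitz_onI)
    show "0 \<le> N p + 1" by (simp add: N_def sum_nonneg)
    fix x y assume xy: "x \<in> ball p e" "y \<in> ball p e"
    have "norm (f x - f y) \<le> (N p + 1) * norm (x - y)"
    proof (rule differentiable_bound[OF convex_ball _ _ xy])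
      fix w assume w: "w \<in> ball p e"
      then have dw: "(f has_derivative D w) (at w)" using D e by blast
      then show "(f has_derivative D w) (at w within ball p e)" by (rule has_derivative_at_withinI)
      have "onorm (D w) \<le> N w"
        unfolding N_def using has_derivative_bounded_linear[OF dw] by (rule onorm_componentwise)
      then show "onorm (D w) \<le> N p + 1" using e(2)[OF w] by simp
    qed
    then show "dist (f x) (f y) \<le> (N p + 1) * dist x y" by (simp add: dist_norm)
  qed
  with that e(1) show ?thesis by blast
qed

lemma smooth_compose_locally_lipschitz:
  assumes "open U" "smooth_on U f" "open V" "smooth_on V g" "p \<in> U" "f p \<in> V"
  obtains L e where "e > 0" "L-lipschitz_on (ball p e) (\<lambda>x. g (f x))"
proof -
  define W where "W = U \<inter> f -` V"
  have W: "open W" unfolding W_def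
    by (rule continuous_open_preimage[OF smooth_on_imp_continuous_on[OF assms(2)] assms(1,3)])
  have "smooth_on W (\<lambda>x. g (f x))"
    by (rule smooth_on_compose[OF W assms(3,4) smooth_on_subset[OF assms(2) _ W]])
      (auto simp: W_def)
  moreover have "p \<in> W" using assms(5,6) by (simp add: W_def)
  ultimately show ?thesis by (rule smooth_on_imp_locally_lipschitz[OF W]) (rule that)
qed

text \<open>
  Local diffeomorphisms distort distances only by bounded factors. So if \<open>\<gamma>\<close> is equivalent to
  \<open>g\<close>, and another diffeomorphism takes \<open>\<gamma>\<close> to \<open>h\<close>, then the distances between two points of \<open>h\<close> and
  between the corresponding points of \<open>g\<close> are comparable.
\<close>
lemma A_equivalent_imp_bilipschitz:
  fixes \<gamma> :: "real \<Rightarrow> 'b::euclidean_space"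
  assumes equiv: "A_equivalent \<gamma> t0 g 0" and dif: "diffeomorphism U V \<Phi> \<Psi>" and U: "\<gamma> t0 \<in> U"
    and h: "\<forall>\<^sub>F t in nhds t0. \<gamma> t \<in> U \<and> h t = \<Phi> (\<gamma> t)"
    and cont: "isCont \<gamma> t0" "isCont g 0"
  obtains \<psi> d L e where "d \<noteq> 0" "(\<psi> has_field_derivative d) (at 0)" "\<psi> 0 = t0" "e > (0::real)"
    "\<And>s s'. s \<in> ball 0 e \<Longrightarrow> s' \<in> ball 0 e \<Longrightarrow>
      dist (h (\<psi> s)) (h (\<psi> s')) \<le> L * dist (g s) (g s') \<and>
      dist (g s) (g s') \<le> L * dist (h (\<psi> s)) (h (\<psi> s'))"
proof -
  from equiv obtain S T \<phi> \<psi> U' V' \<Phi>' \<Psi>' where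
    src: "diffeomorphism S T \<phi> \<psi>" "t0 \<in> S" "\<phi> t0 = 0" and
    tgt: "diffeomorphism U' V' \<Phi>' \<Psi>'" "\<gamma> t0 \<in> U'" "\<Phi>' (\<gamma> t0) = g 0" and
    g: "\<forall>\<^sub>F s in nhds 0. g s = \<Phi>' (\<gamma> (\<psi> s))"
    unfolding A_equivalent_def by metis
  have \<psi>0: "\<psi> 0 = t0" and T0: "0 \<in> T" and ST: "open S" "open T"
    and sm: "smooth_on S \<phi>" "smooth_on T \<psi>" and inv: "\<And>t. t \<in> T \<Longrightarrow> \<phi> (\<psi> t) = t"
    using src by (auto simp: diffeomorphism_def homeomorphism_def)
  have d\<psi>: "(\<psi> has_field_derivative deriv \<psi> 0) (at 0)"
    using smooth_on_imp_has_field_derivative[OF ST(2) sm(2) T0] .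
  have "(\<phi> has_field_derivative deriv \<phi> t0) (at (\<psi> 0))"
    using smooth_on_imp_has_field_derivative[OF ST(1) sm(1) src(2)] by (simp add: \<psi>0)
  \<comment> \<open>the chain rule for \<open>\<phi> \<circ> \<psi> = id\<close> shows that the derivative of \<open>\<psi>\<close> does not vanish\<close>
  from DERIV_chain2[OF this d\<psi>]
  have "((\<lambda>s. s) has_field_derivative deriv \<phi> t0 * deriv \<psi> 0) (at 0)"
    by (rule has_field_derivative_transform_within_open[OF _ ST(2) T0]) (rule inv)
  then have "deriv \<phi> t0 * deriv \<psi> 0 = 1" using DERIV_unique[OF DERIV_ident] by metis
  then have dn: "deriv \<psi> 0 \<noteq> 0" by auto
  have "filterlim \<psi> (nhds (\<psi> 0)) (nhds 0)"
    using DERIV_isCont[OF d\<psi>] by (simp add: isCont_def tendsto_at_iff_tendsto_nhds)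
  then have \<psi>lim: "filterlim \<psi> (nhds t0) (nhds 0)" by (simp only: \<psi>0)
  have \<gamma>lim: "filterlim \<gamma> (nhds (\<gamma> t0)) (nhds t0)" and glim: "filterlim g (nhds (g 0)) (nhds 0)"
    using cont by (auto simp: isCont_def tendsto_at_iff_tendsto_nhds)
  have UV: "open U" "open V" "smooth_on U \<Phi>" "smooth_on V \<Psi>"
    "\<And>p. p \<in> U \<Longrightarrow> \<Phi> p \<in> V \<and> \<Psi> (\<Phi> p) = p"
    using dif by (auto simp: diffeomorphism_def homeomorphism_def)
  have UV': "open U'" "open V'" "smooth_on U' \<Phi>'" "smooth_on V' \<Psi>'"
    "\<And>p. p \<in> U' \<Longrightarrow> \<Phi>' p \<in> V' \<and> \<Psi>' (\<Phi>' p) = p"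
    using tgt(1) by (auto simp: diffeomorphism_def homeomorphism_def)
  have h0: "h t0 = \<Phi> (\<gamma> t0)" using eventually_nhds_x_imp_x[OF h] by simp
  obtain L1 e1 where L1: "e1 > 0" "L1-lipschitz_on (ball (g 0) e1) (\<lambda>p. \<Phi> (\<Psi>' p))"
    using smooth_compose_locally_lipschitz[OF UV'(2,4) UV(1,3), of "g 0"] UV'(5)[OF tgt(2)] tgt(3) U
    by metis
  obtain L2 e2 where L2: "e2 > 0" "L2-lipschitz_on (ball (h t0) e2) (\<lambda>p. \<Phi>' (\<Psi> p))"
    using smooth_compose_locally_lipschitz[OF UV(2,4) UV'(1,3), of "h t0"] UV(5)[OF U] h0 tgt(2)
    by metis
  have "\<forall>\<^sub>F s in nhds 0. g s \<in> ball (g 0) e1"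
    by (rule eventually_compose_filterlim[OF eventually_nhds_in_open glim]) (use L1 in auto)
  moreover have "\<forall>\<^sub>F s in nhds 0. \<gamma> (\<psi> s) \<in> U \<and> h (\<psi> s) = \<Phi> (\<gamma> (\<psi> s))"
    using eventually_compose_filterlim[OF h \<psi>lim] .
  moreover have "\<forall>\<^sub>F s in nhds 0. \<gamma> (\<psi> s) \<in> U'"
    by (intro eventually_compose_filterlim[OF _ \<psi>lim] eventually_compose_filterlim[OF _ \<gamma>lim]
        eventually_nhds_in_open UV' tgt)
  moreover have "\<forall>\<^sub>F s in nhds 0. h (\<psi> s) \<in> ball (h t0) e2"
  proof -
    have "isCont \<Phi> (\<gamma> t0)" using smooth_on_imp_isCont[OF UV(1,3) U] .
    then have "filterlim \<Phi> (nhds (h t0)) (nhds (\<gamma> t0))"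
      by (simp add: isCont_def tendsto_at_iff_tendsto_nhds h0)
    then have "\<forall>\<^sub>F q in nhds (\<gamma> t0). \<Phi> q \<in> ball (h t0) e2"
      by (rule eventually_compose_filterlim[OF eventually_nhds_in_open, rotated 2]) (use L2 in auto)
    then have "\<forall>\<^sub>F s in nhds 0. \<Phi> (\<gamma> (\<psi> s)) \<in> ball (h t0) e2"
      by (intro eventually_compose_filterlim[OF _ \<psi>lim] eventually_compose_filterlim[OF _ \<gamma>lim])
    then show ?thesis
      using eventually_compose_filterlim[OF h \<psi>lim] by eventually_elim simp
  qed
  ultimately have "\<forall>\<^sub>F s in nhds 0. g s \<in> ball (g 0) e1 \<and> h (\<psi> s) \<in> ball (h t0) e2 \<and>
      h (\<psi> s) = \<Phi> (\<Psi>' (g s)) \<and> g s = \<Phi>' (\<Psi> (h (\<psi> s)))"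
    using g
  proof eventually_elim
    case (elim s)
    then show ?case using UV(5)[of "\<gamma> (\<psi> s)"] UV'(5)[of "\<gamma> (\<psi> s)"] by metis
  qed
  then obtain e where e: "e > 0" "\<And>s. s \<in> ball 0 e \<Longrightarrow> g s \<in> ball (g 0) e1 \<and> h (\<psi> s) \<in> ball (h t0) e2 \<and>
      h (\<psi> s) = \<Phi> (\<Psi>' (g s)) \<and> g s = \<Phi>' (\<Psi> (h (\<psi> s)))"
    unfolding eventually_nhds_metric mem_ball by (metis dist_commute)
  show ?thesis
  proof (rule that[OF dn d\<psi> \<psi>0 e(1), of "max L1 L2"])
    fix s s' :: real assume s: "s \<in> ball 0 e" "s' \<in> ball 0 e"
    have "dist (h (\<psi> s)) (h (\<psi> s')) \<le> L1 * dist (g s) (g s')"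
      using lipschitz_onD[OF L1(2)] e(2)[OF s(1)] e(2)[OF s(2)] by metis
    moreover have "dist (g s) (g s') \<le> L2 * dist (h (\<psi> s)) (h (\<psi> s'))"
      using lipschitz_onD[OF L2(2)] e(2)[OF s(1)] e(2)[OF s(2)] by metis
    moreover have "L1 * dist (g s) (g s') \<le> max L1 L2 * dist (g s) (g s')"
      "L2 * dist (h (\<psi> s)) (h (\<psi> s')) \<le> max L1 L2 * dist (h (\<psi> s)) (h (\<psi> s'))"
      by (auto intro!: mult_right_mono)
    ultimately show "dist (h (\<psi> s)) (h (\<psi> s')) \<le> max L1 L2 * dist (g s) (g s') \<and>
      dist (g s) (g s') \<le> max L1 L2 * dist (h (\<psi> s)) (h (\<psi> s'))" by linarith
  qed
qed

lemma A_equivalentI: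
  assumes "diffeomorphism S T \<phi> \<psi>" "t0 \<in> S" "\<phi> t0 = q"
    and "diffeomorphism U V \<Phi> \<Psi>" "\<gamma> t0 \<in> U"
    and ev: "\<forall>\<^sub>F t in nhds t0. \<Phi> (\<gamma> t) = g (\<phi> t)"
  shows "A_equivalent \<gamma> t0 g q"
proof -
  have T: "open T" "q \<in> T" "\<psi> q = t0" "continuous_on T \<psi>" "\<And>s. s \<in> T \<Longrightarrow> \<phi> (\<psi> s) = s"
    using assms(1-3) by (auto simp: diffeomorphism_def homeomorphism_def)
  then have "filterlim \<psi> (nhds t0) (nhds q)"
    by (auto simp: continuous_on_eq_continuous_at isCont_def tendsto_at_iff_tendsto_nhds)
  then have "\<forall>\<^sub>F s in nhds q. \<Phi> (\<gamma> (\<psi> s)) = g (\<phi> (\<psi> s))"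
    using ev eventually_compose_filterlim by fastforce
  moreover have "\<forall>\<^sub>F s in nhds q. s \<in> T" using T by (simp add: eventually_nhds_in_open)
  ultimately have "\<forall>\<^sub>F s in nhds q. g s = \<Phi> (\<gamma> (\<psi> s))"
    by eventually_elim (use T(5) in auto)
  moreover have "\<Phi> (\<gamma> t0) = g q" using eventually_nhds_x_imp_x[OF ev] assms(3) by simp
  ultimately show ?thesis unfolding A_equivalent_def using assms by blast
qed

section \<open>Orders of vanishing\<close>

text \<open>
  If \<open>p < q\<close>, dividing the bound by \<open>\<bar>t - t0\<bar>\<^sup>p\<close> leaves the factor
  \<open>\<bar>t - t0\<bar>\<^bsup>q - p\<^esup>\<close> on the right, and the limit gives \<open>A = 0\<close>.
\<close>
lemma order_comparison:
  fixes N E :: "real \<Rightarrow> real"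
  assumes N: "((\<lambda>t. N t / \<bar>t - t0\<bar> ^ p) \<longlongrightarrow> A) (at t0)" and A: "A \<noteq> 0"
    and E: "((\<lambda>t. E t / \<bar>t - t0\<bar> ^ q) \<longlongrightarrow> B) (at t0)"
    and le: "\<forall>\<^sub>F t in at t0. \<bar>N t\<bar> \<le> L * \<bar>E t\<bar>"
  shows "q \<le> p"
proof (rule ccontr)
  assume "\<not> q \<le> p"
  then have pq: "q - p > 0" "q = p + (q - p)" by auto
  have "((\<lambda>t. L * \<bar>E t / \<bar>t - t0\<bar> ^ q\<bar> * \<bar>t - t0\<bar> ^ (q - p)) \<longlongrightarrow> L * \<bar>B\<bar> * \<bar>t0 - t0\<bar> ^ (q - p)) (at t0)"
    by (intro tendsto_intros E)
  moreover have "\<forall>\<^sub>F t in at t0. \<bar>N t / \<bar>t - t0\<bar> ^ p\<bar> \<le> L * \<bar>E t / \<bar>t - t0\<bar> ^ q\<bar> * \<bar>t - t0\<bar> ^ (q - p)"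
    using le eventually_at_filter[of "\<lambda>t. t \<noteq> t0" t0 UNIV, simplified]
  proof (eventually_elim)
    case (elim t)
    have nz: "\<bar>t - t0\<bar> > 0" using elim by simp
    have "\<bar>t - t0\<bar> ^ q = \<bar>t - t0\<bar> ^ p * \<bar>t - t0\<bar> ^ (q - p)" using pq(2) by (metis power_add)
    then have "L * \<bar>E t / \<bar>t - t0\<bar> ^ q\<bar> * \<bar>t - t0\<bar> ^ (q - p) = L * \<bar>E t\<bar> / \<bar>t - t0\<bar> ^ p"
      using nz by (simp add: abs_divide)
    moreover have "\<bar>N t / \<bar>t - t0\<bar> ^ p\<bar> \<le> L * \<bar>E t\<bar> / \<bar>t - t0\<bar> ^ p"
      using elim by (simp add: abs_divide divide_right_mono)
    ultimately show ?case by simp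
  qed
  ultimately have "\<bar>A\<bar> \<le> L * \<bar>B\<bar> * \<bar>t0 - t0\<bar> ^ (q - p)"
    using tendsto_le[OF trivial_limit_at _ tendsto_rabs[OF N]] by blast
  moreover have "\<bar>t0 - t0\<bar> ^ (q - p) = 0" using pq(1) by simp
  ultimately have "\<bar>A\<bar> \<le> 0" by (metis mult_zero_right)
  then show False using A by simp
qed

lemma has_ord_unique: "has_ord f t0 k \<Longrightarrow> has_ord f t0 l \<Longrightarrow> k = l"
  unfolding has_ord_def by (metis linorder_neqE_nat)

lemma has_ord_Suc_iff: "has_ord f t0 (Suc k) \<longleftrightarrow> f t0 = 0 \<and> has_ord (deriv f) t0 k"
  unfolding has_ord_def All_less_Suc2
  by (simp add: funpow_Suc_right del: funpow.simps(2))

text \<open>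
  Turns the definition by derivatives into the leading asymptotics, by repeated use of
  l'Hopital's rule.
\<close>
lemma has_ord_imp_tendsto:
  assumes "open S" "t0 \<in> S" "smooth_on S f" "has_ord f t0 k"
  obtains A where "A \<noteq> 0" "((\<lambda>t. f t / (t - t0) ^ k) \<longlongrightarrow> A) (at t0)"
proof -
  have "\<exists>A. A \<noteq> 0 \<and> ((\<lambda>t. f t / (t - t0) ^ k) \<longlongrightarrow> A) (at t0)"
    using assms(3,4)
  proof (induction k arbitrary: f)
    case 0
    then show ?case
      using smooth_on_imp_isCont[OF assms(1) 0(1) assms(2)] by (auto simp: has_ord_def isCont_def)
  next
    case (Suc k)
    have f: "f t0 = 0" "has_ord (deriv f) t0 k" using Suc.prems(2) by (auto simp: has_ord_Suc_iff)
    obtain A where A: "A \<noteq> 0" "((\<lambda>t. deriv f t / (t - t0) ^ k) \<longlongrightarrow> A) (at t0)"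
      using Suc.IH[OF smooth_on_deriv[OF assms(1) Suc.prems(1)] f(2)] by blast
    have ne: "\<forall>\<^sub>F t in at t0. t \<noteq> t0" by (simp add: eventually_at_filter)
    have "((\<lambda>t. f t / (t - t0) ^ Suc k) \<longlongrightarrow> A / real (Suc k)) (at t0)"
    proof (rule lhopital[where f' = "deriv f" and g' = "\<lambda>t. real (Suc k) * (t - t0) ^ k"])
      show "(f \<longlongrightarrow> 0) (at t0)"
        using smooth_on_imp_isCont[OF assms(1) Suc.prems(1) assms(2)] f(1) by (simp add: isCont_def)
      have "((\<lambda>t. (t - t0) ^ Suc k) \<longlongrightarrow> (t0 - t0) ^ Suc k) (at t0)" by (intro tendsto_intros)
      then show "((\<lambda>t. (t - t0) ^ Suc k) \<longlongrightarrow> 0) (at t0)" by simp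
      show "\<forall>\<^sub>F t in at t0. (t - t0) ^ Suc k \<noteq> 0" "\<forall>\<^sub>F t in at t0. real (Suc k) * (t - t0) ^ k \<noteq> 0"
        using ne by (eventually_elim, simp)+
      have "\<forall>\<^sub>F t in at t0. t \<in> S" using assms(1,2) by (simp add: eventually_at_in_open')
      then show "\<forall>\<^sub>F t in at t0. (f has_field_derivative deriv f t) (at t)"
        by eventually_elim (rule smooth_on_imp_has_field_derivative[OF assms(1) Suc.prems(1)])
      show "\<forall>\<^sub>F t in at t0. ((\<lambda>t. (t - t0) ^ Suc k) has_field_derivative real (Suc k) * (t - t0) ^ k) (at t)"
        by (intro always_eventually allI
            DERIV_cong[OF DERIV_power[OF DERIV_diff[OF DERIV_ident DERIV_const]]]) simp
      have "((\<lambda>t. deriv f t / (t - t0) ^ k / real (Suc k)) \<longlongrightarrow> A / real (Suc k)) (at t0)"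
        by (intro tendsto_intros A) simp
      then show "((\<lambda>t. deriv f t / (real (Suc k) * (t - t0) ^ k)) \<longlongrightarrow> A / real (Suc k)) (at t0)"
        by (simp add: mult.commute)
    qed
    then show ?case using A(1) by (intro exI[of _ "A / real (Suc k)"]) simp
  qed
  then show ?thesis using that by blast
qed

section \<open>Exponents of a cusp\<close>

text \<open>
  Comparing the distances to the origin gives \<open>\<bar>s\<bar>\<^sup>i \<sim> u\<^sup>2 \<sim> \<bar>s\<bar>\<^bsup>2 k\<^esup>\<close> up to constant factors.
  The exponent \<open>j\<close> is seen by comparing the points with parameters \<open>s\<close> and \<open>-s\<close>: since \<open>i\<close> is even and
  \<open>j\<close> is odd, their distance on the cusp is \<open>2 \<bar>s\<bar>\<^sup>j\<close>, whereas for odd \<open>k\<close> the function \<open>u\<close> changes sign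
  and the cubes \<open>u\<^sup>3\<close> differ by about \<open>2 \<bar>A\<bar>\<^sup>3 \<bar>s\<bar>\<^bsup>3 k\<^esup>\<close>.
\<close>
lemma bilipschitz_powers_imp_exponents:
  fixes u :: "real \<Rightarrow> real"
  assumes u: "((\<lambda>s. u s / s ^ k) \<longlongrightarrow> A) (at 0)" "A \<noteq> 0" "u 0 = 0"
    and ij: "0 < i" "i < j" and e: "e > 0"
    and bilip: "\<And>s s'. s \<in> ball 0 e \<Longrightarrow> s' \<in> ball 0 e \<Longrightarrow>
      dist (u s ^ 2, u s ^ 3) (u s' ^ 2, u s' ^ 3) \<le> L * dist (s ^ i, s ^ j) (s' ^ i, s' ^ j) \<and>
      dist (s ^ i, s ^ j) (s' ^ i, s' ^ j) \<le> L * dist (u s ^ 2, u s ^ 3) (u s' ^ 2, u s' ^ 3)"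
  shows "i = 2 * k" and "odd k \<Longrightarrow> odd j \<Longrightarrow> j \<le> 3 * k"
proof -
  have near: "\<forall>\<^sub>F s in at (0 :: real). s \<in> ball 0 e \<and> - s \<in> ball 0 e \<and> s \<noteq> 0"
    unfolding eventually_at using e by (intro exI[of _ e]) (auto simp: dist_real_def)
  define N where "N = (\<lambda>s. norm (u s ^ 2, u s ^ 3))"
  define E where "E = (\<lambda>s :: real. norm (s ^ i, s ^ j))"
  have uabs: "((\<lambda>s. \<bar>u s\<bar> / \<bar>s\<bar> ^ k) \<longlongrightarrow> \<bar>A\<bar>) (at 0)"
    using tendsto_rabs[OF u(1)] by (simp add: abs_divide power_abs)
  have "((\<lambda>s. norm ((\<bar>u s\<bar> / \<bar>s\<bar> ^ k) ^ 2, (\<bar>u s\<bar> / \<bar>s\<bar> ^ k) ^ 3 * \<bar>s\<bar> ^ k)) \<longlongrightarrow>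
      norm (\<bar>A\<bar> ^ 2, \<bar>A\<bar> ^ 3 * \<bar>0\<bar> ^ k)) (at 0)"
    by (intro tendsto_intros uabs)
  moreover have "norm ((\<bar>u s\<bar> / \<bar>s\<bar> ^ k) ^ 2, (\<bar>u s\<bar> / \<bar>s\<bar> ^ k) ^ 3 * \<bar>s\<bar> ^ k) = N s / \<bar>s\<bar> ^ (2 * k)"
    if "s \<noteq> 0" for s
  proof -
    define q where "q = \<bar>s\<bar> ^ k"
    have q: "q > 0" using that by (simp add: q_def)
    have "((\<bar>u s\<bar> / q) ^ 2, (\<bar>u s\<bar> / q) ^ 3 * q) = (1 / q\<^sup>2) *\<^sub>R (\<bar>u s\<bar> ^ 2, \<bar>u s\<bar> ^ 3)"
      using q by (simp add: power_divide power2_eq_square power3_eq_cube)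
    then have "norm ((\<bar>u s\<bar> / q) ^ 2, (\<bar>u s\<bar> / q) ^ 3 * q) = (1 / q\<^sup>2) * norm (\<bar>u s\<bar> ^ 2, \<bar>u s\<bar> ^ 3)"
      using q by (simp only: norm_scaleR) simp
    moreover have "norm (\<bar>u s\<bar> ^ 2, \<bar>u s\<bar> ^ 3) = N s"
      by (simp add: N_def norm_Pair power_abs)
    moreover have "q\<^sup>2 = \<bar>s\<bar> ^ (2 * k)" by (simp add: q_def power_mult[symmetric] mult.commute)
    ultimately show ?thesis by (simp add: q_def)
  qed
  ultimately have N: "((\<lambda>s. N s / \<bar>s - 0\<bar> ^ (2 * k)) \<longlongrightarrow> norm (\<bar>A\<bar> ^ 2, \<bar>A\<bar> ^ 3 * \<bar>0\<bar> ^ k)) (at 0)"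
    by (subst tendsto_cong) (auto simp: eventually_at_filter)
  have "((\<lambda>s :: real. norm (1 :: real, \<bar>s\<bar> ^ (j - i))) \<longlongrightarrow> norm (1 :: real, \<bar>0 :: real\<bar> ^ (j - i))) (at 0)"
    by (intro tendsto_intros)
  moreover have "norm (1 :: real, \<bar>s\<bar> ^ (j - i)) = E s / \<bar>s\<bar> ^ i" if "s \<noteq> 0" for s :: real
  proof -
    have "\<bar>s\<bar> ^ j = \<bar>s\<bar> ^ i * \<bar>s\<bar> ^ (j - i)" using ij by (simp add: power_add[symmetric])
    then have "(\<bar>s\<bar> ^ i, \<bar>s\<bar> ^ j) = (\<bar>s\<bar> ^ i) *\<^sub>R (1 :: real, \<bar>s\<bar> ^ (j - i))" by simp
    then have "norm (\<bar>s\<bar> ^ i, \<bar>s\<bar> ^ j) = \<bar>s\<bar> ^ i * norm (1 :: real, \<bar>s\<bar> ^ (j - i))"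
      by (simp only: norm_scaleR) simp
    moreover have "norm (\<bar>s\<bar> ^ i, \<bar>s\<bar> ^ j) = E s"
      by (simp add: E_def norm_Pair power_abs[symmetric])
    ultimately show ?thesis using that by simp
  qed
  ultimately have E: "((\<lambda>s. E s / \<bar>s - 0\<bar> ^ i) \<longlongrightarrow> norm (1 :: real, \<bar>0 :: real\<bar> ^ (j - i))) (at 0)"
    by (subst tendsto_cong) (auto simp: eventually_at_filter)
  have NE: "N s \<le> L * E s" "E s \<le> L * N s" if "s \<in> ball 0 e" for s
    using bilip[OF that, of 0] e u(3) ij by (simp_all add: N_def E_def dist_norm zero_power)
  have "i \<le> 2 * k"
    by (rule order_comparison[OF N _ E, where L = L])
      (use near u(2) NE(1) in \<open>auto simp: N_def E_def zero_prod_def elim!: eventually_mono\<close>)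
  moreover have "2 * k \<le> i"
    by (rule order_comparison[OF E _ N, where L = L])
      (use near u(2) NE(2) in \<open>auto simp: N_def E_def zero_prod_def elim!: eventually_mono\<close>)
  ultimately show i: "i = 2 * k" by simp
  assume odd: "odd k" "odd j"
  \<comment> \<open>the comparison of the parameters \<open>s\<close> and \<open>-s\<close>\<close>
  define M where "M = (\<lambda>s. u s ^ 3 - u (- s) ^ 3)"
  have "((\<lambda>s. u (- s) / (- s) ^ k) \<longlongrightarrow> A) (at 0)"
    using u(1) by (rule filterlim_compose) (simp add: filterlim_at eventually_at_filter tendsto_minus_cancel_left[symmetric])
  then have "((\<lambda>s. - (u (- s) / s ^ k)) \<longlongrightarrow> A) (at 0)"
    using odd by simp
  then have "((\<lambda>s. \<bar>(u s / s ^ k) ^ 3 + (- (u (- s) / s ^ k)) ^ 3\<bar>) \<longlongrightarrow> \<bar>A ^ 3 + A ^ 3\<bar>) (at 0)"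
    by (intro tendsto_intros u)
  moreover have "\<bar>(u s / s ^ k) ^ 3 + (- (u (- s) / s ^ k)) ^ 3\<bar> = \<bar>M s\<bar> / \<bar>s - 0\<bar> ^ (3 * k)" for s
  proof -
    have "(u s / s ^ k) ^ 3 + (- (u (- s) / s ^ k)) ^ 3 = M s / s ^ (3 * k)"
      by (simp add: M_def power_divide power_mult[symmetric] mult.commute diff_divide_distrib)
    then show ?thesis by (simp add: abs_divide power_abs)
  qed
  ultimately have M: "((\<lambda>s. \<bar>M s\<bar> / \<bar>s - 0\<bar> ^ (3 * k)) \<longlongrightarrow> \<bar>A ^ 3 + A ^ 3\<bar>) (at 0)"
    by simp
  have F: "((\<lambda>s. (2 * \<bar>s\<bar> ^ j) / \<bar>s - 0\<bar> ^ j) \<longlongrightarrow> 2) (at (0 :: real))"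
    by (rule tendsto_eventually) (auto simp: eventually_at_filter)
  have MF: "\<bar>M s\<bar> \<le> L * (2 * \<bar>s\<bar> ^ j)" if s: "s \<in> ball 0 e" "- s \<in> ball 0 e" for s
  proof -
    have "\<bar>M s\<bar> \<le> dist (u s ^ 2, u s ^ 3) (u (- s) ^ 2, u (- s) ^ 3)"
      using dist_snd_le[of "(u s ^ 2, u s ^ 3)" "(u (- s) ^ 2, u (- s) ^ 3)"]
      by (simp add: M_def dist_real_def)
    also have "\<dots> \<le> L * dist (s ^ i, s ^ j) ((- s) ^ i, (- s) ^ j)" using bilip[OF s] by simp
    also have "dist (s ^ i, s ^ j) ((- s) ^ i, (- s) ^ j) = 2 * \<bar>s\<bar> ^ j"
      using i odd by (simp add: dist_Pair_Pair dist_real_def power_mult_distrib real_sqrt_mult power_abs flip: mult_2)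
    finally show ?thesis .
  qed
  show "j \<le> 3 * k"
    by (rule order_comparison[OF M _ F, where L = L])
      (use near u(2) MF in \<open>auto elim!: eventually_mono\<close>)
qed

section \<open>The differential equations of the profile\<close>

lemma legendre_curve_components_smooth:
  assumes "legendre_curve I (\<lambda>t. (x t, z t)) (\<lambda>t. (a t, b t))" "open T" "T \<subseteq> I"
  shows "smooth_on T x" "smooth_on T z" "smooth_on T a" "smooth_on T b"
proof -
  have "smooth_on T (\<lambda>t. (x t, z t))" "smooth_on T (\<lambda>t. (a t, b t))"
    using assms(1) smooth_on_subset[OF _ assms(3,2)] by (auto simp: legendre_curve_def)
  then show "smooth_on T x" "smooth_on T z" "smooth_on T a" "smooth_on T b"
    using smooth_on_fst[OF assms(2), of "\<lambda>t. (x t, z t)"] smooth_on_snd[OF assms(2), of "\<lambda>t. (x t, z t)"]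
      smooth_on_fst[OF assms(2), of "\<lambda>t. (a t, b t)"] smooth_on_snd[OF assms(2), of "\<lambda>t. (a t, b t)"]
    by simp_all
qed

text \<open>
  The Frenet equations. The tangency and unit length conditions say that \<open>\<gamma>'\<close> and \<open>\<nu>'\<close> are
  orthogonal to \<open>\<nu>\<close>, so both are multiples of the rotated normal, with the curvatures as factors.
\<close>
lemma interior_legendre_equations:
  fixes x z a b :: "real \<Rightarrow> real"
  assumes leg: "legendre_curve I (\<lambda>t. (x t, z t)) (\<lambda>t. (a t, b t))" and t: "t \<in> interior I"
  defines "\<beta> \<equiv> leg_beta I (\<lambda>t. (x t, z t)) (\<lambda>t. (a t, b t)) t"
    and "l \<equiv> leg_ell I (\<lambda>t. (a t, b t)) t"
  shows "\<beta> = - deriv x t * b t + deriv z t * a t"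
    and "(a t)\<^sup>2 + (b t)\<^sup>2 = 1"
    and "(x has_field_derivative - \<beta> * b t) (at t)" "(z has_field_derivative \<beta> * a t) (at t)"
    and "(a has_field_derivative - l * b t) (at t)" "(b has_field_derivative l * a t) (at t)"
proof -
  define T where "T = interior I"
  have T: "open T" "T \<subseteq> I" "t \<in> T" using t interior_subset by (auto simp: T_def)
  note comp = legendre_curve_components_smooth[OF leg T(1,2)]
  note D = smooth_on_imp_has_field_derivative[OF T(1) _ T(3)]
  have vd: "vector_derivative (\<lambda>t. (f t, g t)) (at t within I) = (deriv f t, deriv g t)"
    if "smooth_on T f" "smooth_on T g" for f g
    unfolding at_within_interior[OF t]
    by (rule vector_derivative_at has_vector_derivative_Pair)+
      (use D that in \<open>simp_all add: has_real_derivative_iff_has_vector_derivative\<close>)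
  have unit: "(a s)\<^sup>2 + (b s)\<^sup>2 = 1" if "s \<in> T" for s
    using leg that T(2) by (auto simp: legendre_curve_def norm_Pair)
  then show u: "(a t)\<^sup>2 + (b t)\<^sup>2 = 1" using T(3) by blast
  have tang: "deriv x t * a t + deriv z t * b t = 0"
  proof -
    have "t \<in> I" using T by blast
    then have "vector_derivative (\<lambda>t. (x t, z t)) (at t within I) \<bullet> (a t, b t) = 0"
      using leg unfolding legendre_curve_def by blast
    then show ?thesis by (simp add: vd[OF comp(1,2)])
  qed
  show \<beta>: "\<beta> = - deriv x t * b t + deriv z t * a t"
    using vd[OF comp(1,2)] by (simp add: \<beta>_def leg_beta_def rot90_def)
  have l: "l = - deriv a t * b t + deriv b t * a t"
    using vd[OF comp(3,4)] by (simp add: l_def leg_ell_def rot90_def)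
  have "((\<lambda>t. (a t)\<^sup>2 + (b t)\<^sup>2) has_field_derivative 2 * a t * deriv a t + 2 * b t * deriv b t) (at t)"
    by (rule derivative_eq_intros D comp refl | simp)+
  moreover have "((\<lambda>t. (a t)\<^sup>2 + (b t)\<^sup>2) has_field_derivative 0) (at t)"
    by (rule has_field_derivative_transform_within_open[OF DERIV_const[of 1] T(1,3)]) (simp add: unit)
  ultimately have "2 * a t * deriv a t + 2 * b t * deriv b t = 0" by (rule DERIV_unique)
  then have orth: "a t * deriv a t + b t * deriv b t = 0" by simp
  have "deriv x t = - \<beta> * b t" "deriv z t = \<beta> * a t"
    using u tang unfolding \<beta> by algebra+
  moreover have "deriv a t = - l * b t" "deriv b t = l * a t"
    using u orth unfolding l by algebra+
  ultimately show "(x has_field_derivative - \<beta> * b t) (at t)" "(z has_field_derivative \<beta> * a t) (at t)"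
    "(a has_field_derivative - l * b t) (at t)" "(b has_field_derivative l * a t) (at t)"
    using D[OF comp(1)] D[OF comp(2)] D[OF comp(3)] D[OF comp(4)] by simp_all
qed

text \<open>
  The left-hand side of the equation has order \<open>(m + 1) + m\<close>, and the factor \<open>g\<close> leaves the order
  of \<open>\<beta>\<close> unchanged.
\<close>
lemma order_of_beta:
  fixes a \<beta> g :: "real \<Rightarrow> real"
  assumes T: "open T" "t0 \<in> T" and sm: "smooth_on T a" "smooth_on T \<beta>"
    and g: "isCont g t0" "g t0 \<noteq> 0"
    and eq: "\<And>t. t \<in> T \<Longrightarrow> a t * deriv a t = g t * \<beta> t"
    and ord: "has_ord a t0 (Suc m)" "has_ord \<beta> t0 k"
  shows "k = 2 * m + 1"
proof -
  obtain A where A: "A \<noteq> 0" "((\<lambda>t. a t / (t - t0) ^ Suc m) \<longlongrightarrow> A) (at t0)"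
    using has_ord_imp_tendsto[OF T sm(1) ord(1)] by blast
  have "has_ord (deriv a) t0 m" using ord(1) by (simp add: has_ord_Suc_iff)
  then obtain A' where A': "A' \<noteq> 0" "((\<lambda>t. deriv a t / (t - t0) ^ m) \<longlongrightarrow> A') (at t0)"
    using has_ord_imp_tendsto[OF T smooth_on_deriv[OF T(1) sm(1)]] by blast
  obtain B where B: "B \<noteq> 0" "((\<lambda>t. \<beta> t / (t - t0) ^ k) \<longlongrightarrow> B) (at t0)"
    using has_ord_imp_tendsto[OF T sm(2) ord(2)] by blast
  define N E where "N = (\<lambda>t. \<bar>a t * deriv a t\<bar>)" and "E = (\<lambda>t. \<bar>g t * \<beta> t\<bar>)"
  have "((\<lambda>t. \<bar>a t / (t - t0) ^ Suc m * (deriv a t / (t - t0) ^ m)\<bar>) \<longlongrightarrow> \<bar>A * A'\<bar>) (at t0)"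
    by (intro tendsto_intros A A')
  moreover have "\<bar>a t / (t - t0) ^ Suc m * (deriv a t / (t - t0) ^ m)\<bar> = N t / \<bar>t - t0\<bar> ^ (2 * m + 1)" for t
    by (simp add: N_def abs_mult abs_divide power_abs power_add mult_2 mult.assoc)
  ultimately have N: "((\<lambda>t. N t / \<bar>t - t0\<bar> ^ (2 * m + 1)) \<longlongrightarrow> \<bar>A * A'\<bar>) (at t0)" by simp
  have "((\<lambda>t. \<bar>g t * (\<beta> t / (t - t0) ^ k)\<bar>) \<longlongrightarrow> \<bar>g t0 * B\<bar>) (at t0)"
    using g(1) by (intro tendsto_intros B) (simp add: isCont_def)
  moreover have "\<bar>g t * (\<beta> t / (t - t0) ^ k)\<bar> = E t / \<bar>t - t0\<bar> ^ k" for t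
    by (simp add: E_def abs_mult abs_divide power_abs)
  ultimately have E: "((\<lambda>t. E t / \<bar>t - t0\<bar> ^ k) \<longlongrightarrow> \<bar>g t0 * B\<bar>) (at t0)" by simp
  have "\<forall>\<^sub>F t in at t0. t \<in> T" using T by (simp add: eventually_at_in_open')
  then have NE: "\<forall>\<^sub>F t in at t0. N t = E t"
    by eventually_elim (simp add: N_def E_def eq)
  have "k \<le> 2 * m + 1"
    by (rule order_comparison[OF N _ E, where L = 1])
      (use A A' NE in \<open>auto elim!: eventually_mono\<close>)
  moreover have "2 * m + 1 \<le> k"
    by (rule order_comparison[OF E _ N, where L = 1])
      (use g B NE in \<open>auto elim!: eventually_mono\<close>)
  ultimately show ?thesis by simp
qed

section \<open>Cusps of constant Gauss curvature profiles\<close>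

theorem proposition3p21:
  fixes I :: "real set" and t0 :: real
    and \<gamma> \<nu> :: "real \<Rightarrow> real \<times> real"
    and x z a b \<l> \<beta> J K \<alpha> :: "real \<Rightarrow> real"
    and c :: real and m n :: nat
  assumes interval: "is_interval I" "t0 \<in> interior I"
    and legendre: "legendre_curve I \<gamma> \<nu>"
    and gamma: "\<And>t. \<gamma> t = (x t, z t)"
    and nu: "\<And>t. \<nu> t = (a t, b t)"
    and ell: "\<And>t. \<l> t = leg_ell I \<nu> t"
    and beta: "\<And>t. \<beta> t = leg_beta I \<gamma> \<nu> t"
    and beta_analytic: "real_analytic_around \<beta> t0"
    and J: "\<And>t. J t = - \<beta> t * x t"
    and K: "\<And>t. K t = - a t * \<l> t"
    and K_eq: "\<And>t. t \<in> I \<Longrightarrow> K t = \<alpha> t * J t"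
    and alpha: "\<And>t. t \<in> I \<Longrightarrow> \<alpha> t = c"
    and c: "c \<noteq> 0"
    and x_t0: "x t0 \<noteq> 0"
    and ord_a: "has_ord a t0 (m + 1)"
    and ord_beta: "has_ord \<beta> t0 (n + 1)"
    and ord_le: "m + 1 \<le> n + 1"
  shows "(has_cusp 3 2 \<gamma> t0 \<longleftrightarrow> has_ord a t0 1 \<and> has_ord \<beta> t0 1) \<and>
         (has_cusp 4 3 \<gamma> t0 \<longleftrightarrow> has_ord a t0 2 \<and> has_ord \<beta> t0 2) \<and>
         (has_cusp 5 3 \<gamma> t0 \<longleftrightarrow> has_ord a t0 1 \<and> has_ord \<beta> t0 2) \<and>
         \<not> has_cusp 5 2 \<gamma> t0"
proof -
  define T where "T = interior I"
  have T: "open T" "T \<subseteq> I" "t0 \<in> T" using interval interior_subset by (auto simp: T_def)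
  have \<gamma>: "\<gamma> = (\<lambda>t. (x t, z t))" and \<nu>: "\<nu> = (\<lambda>t. (a t, b t))" using gamma nu by auto
  have leg: "legendre_curve I (\<lambda>t. (x t, z t)) (\<lambda>t. (a t, b t))" using legendre by (simp add: \<gamma> \<nu>)
  note sm = legendre_curve_components_smooth[OF leg T(1,2)]
  note eqs = interior_legendre_equations[OF leg, folded T_def, folded \<gamma> \<nu>, folded beta ell]
  have Kc: "a t * \<l> t = c * \<beta> t * x t" if "t \<in> T" for t
    using K_eq[of t] alpha[of t] T(2) that by (auto simp: J K)
  have a0: "a t0 = 0" using ord_a by (simp add: has_ord_Suc_iff)
  \<comment> \<open>the Frenet equation \<open>a' = - \<l> b\<close> and the curvature equation give
    \<open>a a' = - c x b \<beta>\<close>, which ties the two orders together\<close>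
  have b0: "b t0 \<noteq> 0" using eqs(2)[OF T(3)] a0 by auto
  have s\<beta>: "smooth_on T \<beta>"
    by (rule smooth_on_cong[of T "\<lambda>t. - deriv x t * b t + deriv z t * a t"])
      (use eqs(1) in \<open>auto intro!: smooth_on_intros smooth_on_deriv T(1) sm\<close>)
  have "isCont (\<lambda>t. - (c * x t * b t)) t0"
    by (rule smooth_on_imp_isCont[OF T(1) _ T(3)]) (intro smooth_on_intros T(1) sm)
  moreover have "a t * deriv a t = - (c * x t * b t) * \<beta> t" if "t \<in> T" for t
  proof -
    have "a t * deriv a t = - (a t * \<l> t) * b t" using DERIV_imp_deriv[OF eqs(5)[OF that]] by simp
    then show ?thesis using Kc[OF that] by simp
  qed
  ultimately have "n + 1 = 2 * m + 1"
    using ord_a ord_beta x_t0 b0 c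
    by (intro order_of_beta[OF T(1,3) sm(3) s\<beta>, of "\<lambda>t. - (c * x t * b t)"]) auto
  then have n: "n = 2 * m" by simp
  have ord_a_iff: "has_ord a t0 k \<longleftrightarrow> k = m + 1" for k
    using ord_a has_ord_unique by blast
  have ord_\<beta>_iff: "has_ord \<beta> t0 k \<longleftrightarrow> k = 2 * m + 1" for k
    using ord_beta has_ord_unique n by blast
  obtain U V \<Phi> \<Psi> where nf: "diffeomorphism U V \<Phi> \<Psi>" "\<gamma> t0 \<in> U"
    "\<forall>\<^sub>F t in nhds t0. \<gamma> t \<in> U \<and> \<Phi> (\<gamma> t) = (a t ^ 2, a t ^ 3)"
    using legendre_normal_form[OF T(1,3) eqs(3,4,5,6,2) Kc c x_t0 a0] unfolding \<gamma> by blast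
  have exponents: "i = 2 * (m + 1) \<and> (odd (m + 1) \<and> odd j \<longrightarrow> j \<le> 3 * (m + 1))"
    if cusp: "has_cusp j i \<gamma> t0" and ij: "0 < i" "i < j" for i j
  proof -
    have cont: "isCont \<gamma> t0" using smooth_on_imp_isCont[OF T(1) smooth_on_Pair[OF T(1) sm(1,2)] T(3)] by (simp add: \<gamma>)
    have cont': "isCont (\<lambda>t :: real. (t ^ i, t ^ j)) 0" by (intro continuous_intros)
    have ev: "\<forall>\<^sub>F t in nhds t0. \<gamma> t \<in> U \<and> (a t ^ 2, a t ^ 3) = \<Phi> (\<gamma> t)"
      using nf(3) by eventually_elim auto
    obtain \<psi> d L e where \<psi>: "d \<noteq> 0" "(\<psi> has_field_derivative d) (at 0)" "\<psi> 0 = t0" "e > (0::real)"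
      and bilip: "\<And>s s'. s \<in> ball 0 e \<Longrightarrow> s' \<in> ball 0 e \<Longrightarrow>
        dist (a (\<psi> s) ^ 2, a (\<psi> s) ^ 3) (a (\<psi> s') ^ 2, a (\<psi> s') ^ 3) \<le> L * dist (s ^ i, s ^ j) (s' ^ i, s' ^ j) \<and>
        dist (s ^ i, s ^ j) (s' ^ i, s' ^ j) \<le> L * dist (a (\<psi> s) ^ 2, a (\<psi> s) ^ 3) (a (\<psi> s') ^ 2, a (\<psi> s') ^ 3)"
      by (rule A_equivalent_imp_bilipschitz[OF cusp[unfolded has_cusp_def] nf(1,2) ev cont cont']) (rule that)
    obtain A where A: "A \<noteq> 0" "((\<lambda>t. a t / (t - t0) ^ (m + 1)) \<longlongrightarrow> A) (at t0)"
      using has_ord_imp_tendsto[OF T(1,3) sm(3) ord_a] by blast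
    \<comment> \<open>\<open>\<psi>\<close> is a change of parameter, so \<open>a \<circ> \<psi>\<close> has the same order as \<open>a\<close>\<close>
    have quot: "((\<lambda>s. (\<psi> s - t0) / s) \<longlongrightarrow> d) (at 0)"
      using \<psi>(2,3) by (simp add: has_field_derivative_iff)
    have ne: "\<forall>\<^sub>F s in at 0. (\<psi> s - t0) / s \<noteq> 0"
      by (rule tendsto_imp_eventually_ne[OF quot \<psi>(1)])
    have "(\<psi> \<longlongrightarrow> t0) (at 0)" using DERIV_isCont[OF \<psi>(2)] \<psi>(3) by (simp add: isCont_def)
    then have "filterlim \<psi> (at t0) (at 0)"
      using ne by (auto simp: filterlim_at elim!: eventually_mono)
    then have "((\<lambda>s. a (\<psi> s) / (\<psi> s - t0) ^ (m + 1)) \<longlongrightarrow> A) (at 0)"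
      by (rule filterlim_compose[OF A(2)])
    then have "((\<lambda>s. a (\<psi> s) / (\<psi> s - t0) ^ (m + 1) * ((\<psi> s - t0) / s) ^ (m + 1)) \<longlongrightarrow> A * d ^ (m + 1)) (at 0)"
      by (intro tendsto_intros quot)
    moreover have "\<forall>\<^sub>F s in at 0. a (\<psi> s) / (\<psi> s - t0) ^ (m + 1) * ((\<psi> s - t0) / s) ^ (m + 1) =
        a (\<psi> s) / s ^ (m + 1)"
      using ne by eventually_elim (simp add: power_divide)
    ultimately have lim: "((\<lambda>s. a (\<psi> s) / s ^ (m + 1)) \<longlongrightarrow> A * d ^ (m + 1)) (at 0)"
      using tendsto_cong by fast
    have "A * d ^ (m + 1) \<noteq> 0" "a (\<psi> 0) = 0" using A \<psi> a0 by auto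
    then show ?thesis
      using bilipschitz_powers_imp_exponents[of "\<lambda>s. a (\<psi> s)" "m + 1" "A * d ^ (m + 1)" i j e L, OF lim _ _ ij \<psi>(4) bilip]
      by blast
  qed
  have no43: "\<not> has_cusp 4 3 \<gamma> t0" and no53: "\<not> has_cusp 5 3 \<gamma> t0"
    using exponents[of 4 3] exponents[of 5 3] by auto
  have no52: "\<not> has_cusp 5 2 \<gamma> t0"
    using exponents[of 5 2] by auto
  have only0: "m = 0" if "has_cusp 3 2 \<gamma> t0" using exponents[OF that] by simp
  have cusp0: "has_cusp 3 2 \<gamma> t0" if "m = 0"
  proof -
    \<comment> \<open>here \<open>a\<close> itself is the parameter in which the normal form becomes \<open>(s\<^sup>2, s\<^sup>3)\<close>\<close>
    have "deriv a t0 \<noteq> 0" using ord_a that by (simp add: has_ord_def)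
    then obtain S W g where src: "diffeomorphism S W a g" "t0 \<in> S"
      using local_diffeomorphism_real[OF T(1) sm(3) T(3)] by metis
    have "\<forall>\<^sub>F t in nhds t0. \<Phi> (\<gamma> t) = (a t ^ 2, a t ^ 3)"
      using nf(3) by eventually_elim simp
    then show ?thesis unfolding has_cusp_def
      by (rule A_equivalentI[where \<gamma> = \<gamma> and ?t0.0 = t0, OF src a0 nf(1,2)])
  qed
  show ?thesis
    using no43 no53 no52 only0 cusp0 ord_a_iff ord_\<beta>_iff by auto
qed

end
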